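(* Let $G=(V,E)$ be a finite connected graph with $|V|>2$. Consider either of the following two models. (Independent droppings.) Fix a probability vector $p$ on $V$ with $p(i)>0$ for all $i\in V$. The height process $h(t)=(h_j(t))_{j\in V}\in\mathbb{N}_0^V$ is the Markov chain which at each time step chooses $i\in V$ with probability $p(i)$, independently of the past, and replaces $h$ by $T_ih$. (Markov chain droppings.) Fix an irreducible and lazy transition matrix $A=(A(v,v'))_{v,v'\in V}$ (irreducible: for all $v\neq v'$ there is $s$ with $A^s(v,v')>0$; lazy: $A(v,v)>0$ for all $v$). The process $(h(t),v(t))$ is the Markov chain on $\mathbb{N}_0^V\times V$ which jumps from $(h,v)$ to $(T_{v'}h,v')$ with probability $A(v,v')$. Let $x(t)=(x_i(t))_{i\in V}$ with $x_i(t)=h_i(t)-\max_{j\in V}h_j(t)$ be the height profile seen from the maximum, and $m_V(t)=\max_{j\in V}h_j(t)$. Then: 1. $x(t)$ converges in law to an invariant distribution, independently of the starting configuration. 2. There exists a constant $c>0$, depending on the model, such that for all $t$ and $y>0$, $$\mathbb{P}\big(|m_V(t)-\mathbb{E}\,m_V(t)|>y\big)\le 2\exp\Big(-\frac{c\,y^2}{2t}\Big),$$ where this holds both when $\mathbb{P}=\mathbb{P}_\pi$ is the chain in equilibrium (i.e. started with the profile seen from the maximum, together with the position of the driving chain in the Markov case, distributed according to the invariant distribution) and when the chain is started in any fixed initial configuration. 3. There exists a constant $C$ such that $$\sup_t\big|\mathbb{E}_\pi m_V(t)-\mathbb{E}_0 m_V(t)\big|\le C,$$ where $\mathbb{E}_0$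 denotes expectation for the chain started in the flat configuration $h_j=0$ for all $j\in V$.
   Context: For a configuration $h\in\mathbb{N}_0^V$ and $i\in V$, the particle-adding operator $T_i$ is defined by $(T_ih)_i=\max\{h_k:\operatorname{dist}(k,i)\le 1\}+1$ and $(T_ih)_j=h_j$ for $j\neq i$, where $\operatorname{dist}$ is the graph distance in $G$ (so a particle dropped at $i$ lands on top of the highest particle among $i$ and its neighbours). *)

theory Defs
  imports "HOL-Probability.Probability"
begin

text \<open>Graphs: the vertex set is the finite type 'v (V = UNIV), edges are given by a
  symmetric irreflexive relation E. Configurations are integer-valued functions on V
  (so that the profile seen from the maximum, which is nonpositive, is itself a
  configuration); fixed initial configurations are required to be nonnegative.\<close>

definition simple_graph :: "('v \<Rightarrow> 'v \<Rightarrow> bool) \<Rightarrow> bool" where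
  "simple_graph E \<longleftrightarrow> (\<forall>u v. E u v \<longrightarrow> E v u) \<and> (\<forall>u. \<not> E u u)"

definition connected_graph :: "('v \<Rightarrow> 'v \<Rightarrow> bool) \<Rightarrow> bool" where
  "connected_graph E \<longleftrightarrow> (\<forall>u v. E\<^sup>*\<^sup>* u v)"

text \<open>Particle-adding operator T_i: dist(k,i) \<le> 1 iff k = i or k adjacent to i.\<close>
definition T_op :: "('v \<Rightarrow> 'v \<Rightarrow> bool) \<Rightarrow> 'v \<Rightarrow> ('v::finite \<Rightarrow> int) \<Rightarrow> ('v \<Rightarrow> int)" where
  "T_op E i h = h(i := Max (h ` {k. k = i \<or> E k i}) + 1)"

definition mV :: "('v::finite \<Rightarrow> int) \<Rightarrow> int" where
  "mV h = Max (range h)"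

definition profile :: "('v::finite \<Rightarrow> int) \<Rightarrow> ('v \<Rightarrow> int)" where
  "profile h = (\<lambda>i. h i - mV h)"

definition law_at :: "('s \<Rightarrow> 's pmf) \<Rightarrow> 's pmf \<Rightarrow> nat \<Rightarrow> 's pmf" where
  "law_at K \<mu> t = ((\<lambda>\<nu>. bind_pmf \<nu> K) ^^ t) \<mu>"

definition K_ind :: "('v \<Rightarrow> 'v \<Rightarrow> bool) \<Rightarrow> 'v pmf \<Rightarrow> ('v::finite \<Rightarrow> int) \<Rightarrow> ('v \<Rightarrow> int) pmf" where
  "K_ind E p h = map_pmf (\<lambda>i. T_op E i h) p"

definition K_mc :: "('v \<Rightarrow> 'v \<Rightarrow> bool) \<Rightarrow> ('v \<Rightarrow> 'v pmf) \<Rightarrow> ('v::finite \<Rightarrow> int) \<times> 'v \<Rightarrow> (('v \<Rightarrow> int) \<times> 'v) pmf" where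
  "K_mc E A s = map_pmf (\<lambda>v'. (T_op E v' (fst s), v')) (A (snd s))"

text \<open>Transition matrix as a kernel A :: 'v \<Rightarrow> 'v pmf; A^s(v,v') = pmf (law_at A (return v) s) v'.\<close>
definition irreducible_kernel :: "('v \<Rightarrow> 'v pmf) \<Rightarrow> bool" where
  "irreducible_kernel A \<longleftrightarrow>
     (\<forall>v v'. v \<noteq> v' \<longrightarrow> (\<exists>s. pmf (law_at A (return_pmf v) s) v' > 0))"

definition lazy_kernel :: "('v \<Rightarrow> 'v pmf) \<Rightarrow> bool" where
  "lazy_kernel A \<longleftrightarrow> (\<forall>v. pmf (A v) v > 0)"

text \<open>Convergence in law on a countable discrete space: expectations of all bounded
  (= bounded continuous for the discrete topology) functions converge.\<close>
definition conv_in_law :: "(nat \<Rightarrow> 'a pmf) \<Rightarrow> 'a pmf \<Rightarrow> bool" where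
  "conv_in_law \<mu>s \<nu> \<longleftrightarrow>
     (\<forall>f :: 'a \<Rightarrow> real. bounded (range f) \<longrightarrow>
        (\<lambda>t. measure_pmf.expectation (\<mu>s t) f) \<longlonglongrightarrow> measure_pmf.expectation \<nu> f)"

definition invariant_ind :: "('v \<Rightarrow> 'v \<Rightarrow> bool) \<Rightarrow> 'v pmf \<Rightarrow> ('v::finite \<Rightarrow> int) pmf \<Rightarrow> bool" where
  "invariant_ind E p \<pi> \<longleftrightarrow> map_pmf profile (bind_pmf \<pi> (K_ind E p)) = \<pi>"

definition invariant_mc :: "('v \<Rightarrow> 'v \<Rightarrow> bool) \<Rightarrow> ('v \<Rightarrow> 'v pmf) \<Rightarrow> (('v::finite \<Rightarrow> int) \<times> 'v) pmf \<Rightarrow> bool" where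
  "invariant_mc E A \<pi> \<longleftrightarrow>
     map_pmf (\<lambda>s. (profile (fst s), snd s)) (bind_pmf \<pi> (K_mc E A)) = \<pi>"

end

theory Submission
  imports Defs
begin

text \<open>
  Independent droppings are Markov chain droppings whose driving kernel does not depend on the
  current position, so only the Markov case needs an argument. There the profile chain satisfies a
  Doeblin condition: following a driven path that visits all vertices often enough lifts every
  height to at least the previous maximum, dropping sufficiently often at one vertex then makes
  this vertex dominate, and repeating the covering path erases all memory of the other heights.
  Doeblin's condition gives the invariant law and convergence to it. It also bounds, uniformly in
  time and in the starting points, the difference of the expected growths of the maximum from two
  starting points. This is the third claim, and it bounds the increments of the martingale
  \<open>E[m_V(t) | F_s]\<close>, so that the second claim follows as in the Azuma--Hoeffding inequality, with
  one additional increment for a random initial profile.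
\<close>

text \<open>The maximum is not a function of the profile. The link is its expected growth over n
  steps, which vertical shifts leave unchanged and which therefore depends only on profile and
  driving position. Between two starting points this growth differs by at most B = N/\<epsilon>, the
  solution of B = (1 - \<epsilon>) B + N: N steps contribute at most N, and the minorisation
  contracts what remains by 1 - \<epsilon>. A martingale increment then lies in an interval of
  length 2B + 1, and n + 1 \<le> 2n for n \<ge> 1 absorbs the increment of the initial law, so c =
  1/(2(B + 1)^2).

  Two obstacles shape the argument. Doeblin's condition asks for one time N and one state reached
  from every start, although initial height differences are unbounded. Laziness pads paths to a
  common length, and configurations that agree above a level c agree above c + n after any n
  droppings, so sufficiently low heights are forgotten whatever their depth. Moreover the profiles
  form an infinite set, so a limit of laws could lose mass; tightness is extracted from the same
  contraction.\<close>

abbreviation (input) EE :: "'a pmf \<Rightarrow> ('a \<Rightarrow> real) \<Rightarrow> real" where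
  "EE p f \<equiv> measure_pmf.expectation p f"

section \<open>Expectations of functions bounded on the support of a discrete law\<close>

lemma integrable_pmf_bounded:
  fixes f :: "'a \<Rightarrow> real"
  assumes "\<And>x. x \<in> set_pmf p \<Longrightarrow> \<bar>f x\<bar> \<le> B"
  shows "integrable (measure_pmf p) f"
  by (rule measure_pmf.integrable_const_bound[where B=B]) (use assms in \<open>auto simp: AE_measure_pmf_iff\<close>)

lemma expectation_pmf_mono:
  fixes f g :: "'a \<Rightarrow> real"
  assumes "\<And>x. x \<in> set_pmf p \<Longrightarrow> \<bar>f x\<bar> \<le> B" "\<And>x. x \<in> set_pmf p \<Longrightarrow> \<bar>g x\<bar> \<le> B'"
    and "\<And>x. x \<in> set_pmf p \<Longrightarrow> f x \<le> g x"
  shows "EE p f \<le> EE p g"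
  by (rule integral_mono_AE[OF integrable_pmf_bounded integrable_pmf_bounded])
     (use assms in \<open>auto simp: AE_measure_pmf_iff\<close>)

lemma expectation_pmf_between:
  fixes f :: "'a \<Rightarrow> real"
  assumes "\<And>x. x \<in> set_pmf p \<Longrightarrow> a \<le> f x \<and> f x \<le> b"
  shows "a \<le> EE p f" "EE p f \<le> b"
proof -
  have *: "\<bar>f x\<bar> \<le> \<bar>a\<bar> + \<bar>b\<bar>" if "x \<in> set_pmf p" for x using assms[OF that] by linarith
  have "EE p (\<lambda>_. a) \<le> EE p f"
    by (rule expectation_pmf_mono[where B="\<bar>a\<bar>", OF _ *]) (use assms in auto)
  then show "a \<le> EE p f" by simp
  have "EE p f \<le> EE p (\<lambda>_. b)"
    by (rule expectation_pmf_mono[where B'="\<bar>b\<bar>", OF *]) (use assms in auto)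
  then show "EE p f \<le> b" by simp
qed

lemma expectation_pmf_cong:
  fixes f g :: "'a \<Rightarrow> real"
  assumes "\<And>x. x \<in> set_pmf p \<Longrightarrow> f x = g x"
  shows "EE p f = EE p g"
  by (rule integral_cong_AE) (use assms in \<open>auto simp: AE_measure_pmf_iff\<close>)

lemma expectation_bind_pmf:
  fixes f :: "'a \<Rightarrow> real"
  assumes "\<And>x. x \<in> set_pmf (bind_pmf p K) \<Longrightarrow> \<bar>f x\<bar> \<le> B"
  shows "EE (bind_pmf p K) f = EE p (\<lambda>x. EE (K x) f)"
proof -
  \<comment> \<open>\<open>integral_bind\<close> wants a bound valid everywhere, while
    \<open>f\<close> (later the maximum height) is bounded only on the support. Clipping changes
    nothing there.\<close>
  let ?g = "\<lambda>x. max (-\<bar>B\<bar>) (min \<bar>B\<bar> (f x))"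
  have eq: "?g x = f x" if "x \<in> set_pmf (bind_pmf p K)" for x
    using assms[OF that] by auto
  have "EE (bind_pmf p K) f = EE (bind_pmf p K) ?g"
    by (rule expectation_pmf_cong) (simp add: eq)
  also have "\<dots> = EE p (\<lambda>x. EE (K x) ?g)"
    unfolding measure_pmf_bind
    by (rule integral_bind[where K="count_space UNIV" and B'=1 and B="\<bar>B\<bar>"])
       (auto simp: measure_pmf.emeasure_space_1 measure_subprob)
  also have "\<dots> = EE p (\<lambda>x. EE (K x) f)"
    by (intro expectation_pmf_cong eq) auto
  finally show ?thesis .
qed

subsection \<open>Iterated kernels\<close>

lemma law_at_0 [simp]: "law_at K \<mu> 0 = \<mu>"
  by (simp add: law_at_def)

lemma law_at_Suc: "law_at K \<mu> (Suc t) = bind_pmf (law_at K \<mu> t) K"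
  by (simp add: law_at_def)

lemma law_at_add: "law_at K \<mu> (s + t) = law_at K (law_at K \<mu> s) t"
  by (induction t) (simp_all add: law_at_Suc)

lemma law_at_bind: "law_at K \<mu> t = bind_pmf \<mu> (\<lambda>s. law_at K (return_pmf s) t)"
  by (induction t) (simp_all add: law_at_Suc bind_assoc_pmf bind_return_pmf')

lemma law_at_return_add:
  "law_at K (return_pmf x) (s + t) = bind_pmf (law_at K (return_pmf x) s) (\<lambda>y. law_at K (return_pmf y) t)"
  by (subst law_at_add) (rule law_at_bind)

text \<open>\<open>law_at\<close> appends steps at the end; inductions that condition on the first
  step need this other decomposition.\<close>

lemma law_at_return_Suc:
  "law_at K (return_pmf x) (Suc t) = bind_pmf (K x) (\<lambda>y. law_at K (return_pmf y) t)"
  using law_at_return_add[of K x 1 t] by (simp add: law_at_Suc bind_return_pmf)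

text \<open>Lumping: a map that intertwines two kernels carries one chain to the other. It serves
  for passing to relative states, for a fixed vertical shift and for forgetting the driving
  position.\<close>

lemma map_law_at:
  assumes "\<And>s. map_pmf P (K s) = Q (P s)"
  shows "map_pmf P (law_at K \<mu> t) = law_at Q (map_pmf P \<mu>) t"
proof (induction t)
  case (Suc t)
  show ?case
    by (simp add: law_at_Suc map_bind_pmf assms Suc[symmetric] bind_map_pmf)
qed simp

lemma law_at_invariant:
  assumes "bind_pmf \<pi> Q = \<pi>"
  shows "law_at Q \<pi> t = \<pi>"
  by (induction t) (simp_all add: law_at_Suc assms)

subsection \<open>Doeblin minorisation\<close>

text \<open>Compare \<open>f\<close> with the two-valued functions that equal \<open>f z\<close> at
  \<open>z\<close> and \<open>a\<close>, respectively \<open>b\<close>, elsewhere. An atom of mass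
  at least \<open>\<epsilon>\<close> pulls both bounds towards \<open>f z\<close>, so the interval
  shrinks by the factor 1 - \<epsilon> whatever \<open>f z\<close> is.\<close>

lemma doeblin_step:
  fixes f :: "'s \<Rightarrow> real"
  assumes "\<epsilon> \<le> pmf p z" and "\<And>x. x \<in> set_pmf p \<Longrightarrow> a \<le> f x \<and> f x \<le> b" and "a \<le> f z" "f z \<le> b"
  shows "a + \<epsilon> * (f z - a) \<le> EE p f" "EE p f \<le> b - \<epsilon> * (b - f z)"
proof -
  have ind: "EE p (\<lambda>x. c + d * indicator {z} x) = c + d * pmf p z" for c d
  proof -
    have "integrable (measure_pmf p) (\<lambda>x. d * indicator {z} x :: real)"
      by (rule integrable_pmf_bounded[where B="\<bar>d\<bar>"]) (auto simp: indicator_def)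
    then show ?thesis
      by (simp add: Bochner_Integration.integral_add measure_pmf_single del: integral_mult_right_zero)
         (simp add: measure_pmf_single)
  qed
  have bd: "\<bar>f x\<bar> \<le> \<bar>a\<bar> + \<bar>b\<bar>" if "x \<in> set_pmf p" for x using assms(2)[OF that] by linarith
  have "EE p (\<lambda>x. a + (f z - a) * indicator {z} x) \<le> EE p f"
    by (rule expectation_pmf_mono[where B="\<bar>a\<bar> + \<bar>f z\<bar>", OF _ bd])
       (use assms in \<open>auto simp: indicator_def\<close>)
  moreover have "\<epsilon> * (f z - a) \<le> (f z - a) * pmf p z"
    using assms by (subst mult.commute) (intro mult_left_mono, auto)
  ultimately show "a + \<epsilon> * (f z - a) \<le> EE p f" unfolding ind by linarith
  have "EE p f \<le> EE p (\<lambda>x. b + (f z - b) * indicator {z} x)"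
    by (rule expectation_pmf_mono[where B'="\<bar>b\<bar> + \<bar>f z\<bar>", OF bd])
       (use assms in \<open>auto simp: indicator_def\<close>)
  moreover have "\<epsilon> * (b - f z) \<le> (b - f z) * pmf p z"
    using assms by (subst mult.commute) (intro mult_left_mono, auto)
  ultimately show "EE p f \<le> b - \<epsilon> * (b - f z)" unfolding ind by (simp add: algebra_simps)
qed

text \<open>The minorising measure is \<open>\<epsilon>\<close> times a point mass, since a suitable
  word of droppings brings every start to one and the same relative state.\<close>

definition doeblin :: "('s \<Rightarrow> 's pmf) \<Rightarrow> nat \<Rightarrow> real \<Rightarrow> 's \<Rightarrow> bool" where
  "doeblin Q N \<epsilon> z \<longleftrightarrow> 0 < N \<and> 0 < \<epsilon> \<and> \<epsilon> \<le> 1 \<and> (\<forall>s. \<epsilon> \<le> pmf (law_at Q (return_pmf s) N) z)"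

text \<open>Each block of N steps moves both ends of the enclosing interval towards the value at
  \<open>z\<close>. That value does not depend on the start, so the new interval again encloses all
  starts at once.\<close>

lemma doeblin_sandwich:
  fixes f :: "'s \<Rightarrow> real"
  assumes D: "doeblin Q N \<epsilon> z" and f: "\<And>s. 0 \<le> f s \<and> f s \<le> 1"
  shows "\<exists>a b. b - a = (1 - \<epsilon>) ^ k \<and> (\<forall>s. a \<le> EE (law_at Q (return_pmf s) (N * k)) f
            \<and> EE (law_at Q (return_pmf s) (N * k)) f \<le> b)"
proof (induction k)
  case 0
  then show ?case using f by (intro exI[of _ 0] exI[of _ 1]) auto
next
  case (Suc k)
  let ?g = "\<lambda>s. EE (law_at Q (return_pmf s) (N * k)) f"
  obtain a b where ab: "b - a = (1 - \<epsilon>) ^ k" "\<And>s. a \<le> ?g s \<and> ?g s \<le> b"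
    using Suc by blast
  have eq: "EE (law_at Q (return_pmf s) (N * Suc k)) f = EE (law_at Q (return_pmf s) N) ?g" for s
    by (simp add: law_at_return_add, rule expectation_bind_pmf[where B=1]) (use f in \<open>auto simp: abs_le_iff intro: order_trans[of _ 0]\<close>)
  have "a + \<epsilon> * (?g z - a) \<le> EE (law_at Q (return_pmf s) N) ?g
     \<and> EE (law_at Q (return_pmf s) N) ?g \<le> b - \<epsilon> * (b - ?g z)" for s
    using D ab(2) by (intro conjI doeblin_step) (auto simp: doeblin_def)
  moreover have "(b - \<epsilon> * (b - ?g z)) - (a + \<epsilon> * (?g z - a)) = (1 - \<epsilon>) * (b - a)"
    by (simp add: algebra_simps)
  ultimately show ?case
    unfolding eq using ab(1)
    by (intro exI[of _ "a + \<epsilon> * (?g z - a)"] exI[of _ "b - \<epsilon> * (b - ?g z)"]) simp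
qed

text \<open>Both laws are mixtures of laws at time \<open>N * k\<close>, and mixing cannot leave the
  interval \<open>[a, b]\<close>. Different times \<open>n\<close> and \<open>m\<close> are allowed,
  so this is also a Cauchy estimate.\<close>

lemma doeblin_close:
  fixes f :: "'s \<Rightarrow> real"
  assumes D: "doeblin Q N \<epsilon> z" and f: "\<And>s. 0 \<le> f s \<and> f s \<le> 1"
    and "N * k \<le> n" "N * k \<le> m"
  shows "\<bar>EE (law_at Q \<mu> n) f - EE (law_at Q \<nu> m) f\<bar> \<le> (1 - \<epsilon>) ^ k"
proof -
  let ?g = "\<lambda>s. EE (law_at Q (return_pmf s) (N * k)) f"
  obtain a b where ab: "b - a = (1 - \<epsilon>) ^ k" "\<And>s. a \<le> ?g s \<and> ?g s \<le> b"
    using doeblin_sandwich[OF D, of f k] f by blast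
  have "a \<le> EE (law_at Q \<mu> n) f \<and> EE (law_at Q \<mu> n) f \<le> b" if "N * k \<le> n" for n \<mu>
  proof -
    have "law_at Q \<mu> n = bind_pmf (law_at Q \<mu> (n - N * k)) (\<lambda>s. law_at Q (return_pmf s) (N * k))"
      using that law_at_add[of Q \<mu> "n - N * k" "N * k"] by (simp add: law_at_bind[of Q "law_at Q \<mu> (n - N * k)"])
    then have "EE (law_at Q \<mu> n) f = EE (law_at Q \<mu> (n - N * k)) ?g"
      by (simp, intro expectation_bind_pmf[where B=1]) (use f in \<open>auto simp: abs_le_iff intro: order_trans[of _ 0]\<close>)
    then show ?thesis using expectation_pmf_between[of _ a ?g b] ab(2) by auto
  qed
  from this[OF assms(3), of \<mu>] this[OF assms(4), of \<nu>] ab(1) show ?thesis by linarith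
qed

lemma finite_prob_close_1:
  assumes "0 < e"
  obtains F where "finite F" "1 - e < measure_pmf.prob p F"
proof -
  have "Infinite_Sum.abs_summable_on (pmf p) UNIV"
    using pmf_abs_summable[of p UNIV] unfolding abs_summable_equivalent .
  then have "pmf p summable_on UNIV"
    by (rule abs_summable_summable)
  moreover have "infsum (pmf p) UNIV = 1"
    using infsetsum_infsum[OF pmf_abs_summable, of p UNIV] infsetsum_pmf_eq_1[of p UNIV] by simp
  ultimately have "(sum (pmf p) \<longlongrightarrow> 1) (finite_subsets_at_top UNIV)"
    using has_sum_infsum[of "pmf p" UNIV] by (simp add: has_sum_def)
  then have "\<forall>\<^sub>F F in finite_subsets_at_top UNIV. 1 - e < sum (pmf p) F"
    using assms by (intro order_tendstoD) auto
  then obtain F where "finite F" "1 - e < sum (pmf p) F"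
    by (auto simp: eventually_finite_subsets_at_top)
  then show ?thesis by (intro that[of F]) (auto simp: measure_measure_pmf_finite)
qed

lemma doeblin_power_small:
  assumes "doeblin Q N \<epsilon> z" "0 < e"
  obtains k where "(1 - \<epsilon>) ^ k < e"
proof -
  have "(\<lambda>k. (1 - \<epsilon>) ^ k) \<longlonglongrightarrow> 0"
    using assms by (intro LIMSEQ_power_zero) (auto simp: doeblin_def)
  then have "\<forall>\<^sub>F k in sequentially. (1 - \<epsilon>) ^ k < e"
    using assms by (intro order_tendstoD) auto
  then show ?thesis using that by (auto simp: eventually_sequentially)
qed

text \<open>The laws from \<open>z\<close> are Cauchy uniformly over events, hence converge
  pointwise to some \<open>r\<close>. Fatou bounds the total mass by one, tightness excludes a loss
  of mass, and Fatou once more gives invariance.\<close>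

lemma doeblin_invariant_exists:
  assumes D: "doeblin Q N \<epsilon> z"
  shows "\<exists>\<pi>. bind_pmf \<pi> Q = \<pi>"
proof -
  define p where "p n = law_at Q (return_pmf z) n" for n
  have close: "\<bar>measure_pmf.prob (p n) F - measure_pmf.prob (p m) F\<bar> \<le> (1 - \<epsilon>) ^ k"
    if "N * k \<le> n" "N * k \<le> m" for n m k F
    using doeblin_close[OF D, of "indicator F" k n m] that by (simp add: p_def indicator_def)
  have "convergent (\<lambda>n. pmf (p n) y)" for y
  proof (rule real_Cauchy_convergent, rule metric_CauchyI)
    fix e :: real assume "0 < e"
    then obtain k where "(1 - \<epsilon>) ^ k < e" using doeblin_power_small[OF D] by blast
    then have "dist (pmf (p m) y) (pmf (p n) y) < e" if "N * k \<le> m" "N * k \<le> n" for m n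
      using close[OF that, of "{y}"] unfolding dist_real_def measure_pmf_single by linarith
    then show "\<exists>M. \<forall>m\<ge>M. \<forall>n\<ge>M. dist (pmf (p m) y) (pmf (p n) y) < e" by blast
  qed
  then obtain r where r: "\<And>y. (\<lambda>n. pmf (p n) y) \<longlonglongrightarrow> r y"
    unfolding convergent_def by metis
  have r0: "0 \<le> r y" for y
    by (rule LIMSEQ_le_const[OF r]) auto
  \<comment> \<open>The weight \<open>c\<close> is 1 for the total mass and the transition
    probability into \<open>y\<close> for invariance.\<close>
  have fatou: "(\<integral>\<^sup>+ x. ennreal (r x * c x) \<partial>count_space UNIV) \<le> ennreal l"
    if c: "\<And>x. 0 \<le> c x"
      and lim: "(\<lambda>n. \<integral>\<^sup>+ x. ennreal (pmf (p n) x * c x) \<partial>count_space UNIV) \<longlonglongrightarrow> ennreal l" for c l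
  proof -
    have "(\<integral>\<^sup>+ x. ennreal (r x * c x) \<partial>count_space UNIV)
        = (\<integral>\<^sup>+ x. liminf (\<lambda>n. ennreal (pmf (p n) x * c x)) \<partial>count_space UNIV)"
      by (intro nn_integral_cong lim_imp_Liminf[symmetric] tendsto_ennrealI tendsto_mult r tendsto_const) auto
    also have "\<dots> \<le> liminf (\<lambda>n. \<integral>\<^sup>+ x. ennreal (pmf (p n) x * c x) \<partial>count_space UNIV)"
      by (rule nn_integral_liminf) auto
    also have "\<dots> = ennreal l" by (rule lim_imp_Liminf[OF _ lim]) auto
    finally show ?thesis .
  qed
  have le1: "(\<integral>\<^sup>+ x. ennreal (r x) \<partial>count_space UNIV) \<le> 1"
    using fatou[of "\<lambda>_. 1" 1] by (simp add: nn_integral_pmf)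
  have ge1: "ennreal (1 - e) \<le> (\<integral>\<^sup>+ x. ennreal (r x) \<partial>count_space UNIV)" if e: "0 < e" for e
  proof -
    \<comment> \<open>A finite set carrying almost all mass at time \<open>N * k\<close> keeps it at
      all later times, because \<open>close\<close> is uniform over events; the bound then passes to
      the limit as a finite sum.\<close>
    obtain k where k: "(1 - \<epsilon>) ^ k < e / 2" using doeblin_power_small[OF D, of "e / 2"] e by auto
    obtain F where F: "finite F" "1 - e / 2 < measure_pmf.prob (p (N * k)) F"
      using finite_prob_close_1[of "e / 2"] e by auto
    have "1 - e \<le> measure_pmf.prob (p n) F" if "N * k \<le> n" for n
      using close[OF order_refl that, of F] k F by linarith
    then have "1 - e \<le> sum r F"
      using F(1) by (intro LIMSEQ_le_const[OF tendsto_sum[OF r]] exI[of _ "N * k"])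
        (auto simp: measure_measure_pmf_finite)
    then have "ennreal (1 - e) \<le> ennreal (sum r F)" by (rule ennreal_leI)
    also have "\<dots> = (\<integral>\<^sup>+ x. ennreal (r x) * indicator F x \<partial>count_space UNIV)"
      using F(1) r0 by (subst nn_integral_indicator_finite) (auto simp: sum_ennreal)
    also have "\<dots> \<le> (\<integral>\<^sup>+ x. ennreal (r x) \<partial>count_space UNIV)"
      by (intro nn_integral_mono) (auto simp: indicator_def)
    finally show ?thesis .
  qed
  have total: "(\<integral>\<^sup>+ x. ennreal (r x) \<partial>count_space UNIV) = 1"
  proof -
    have "(\<integral>\<^sup>+ x. ennreal (r x) \<partial>count_space UNIV) < \<top>"
      using le1 by (rule le_less_trans) simp
    then obtain x where x: "(\<integral>\<^sup>+ x. ennreal (r x) \<partial>count_space UNIV) = ennreal x" "0 \<le> x"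
      by (cases "\<integral>\<^sup>+ x. ennreal (r x) \<partial>count_space UNIV" rule: ennreal_cases) auto
    have "1 \<le> x + e" if "0 < e" for e
      using ge1[OF that] x by (simp add: ennreal_le_iff)
    then have "1 \<le> x" by (rule field_le_epsilon)
    then show ?thesis using x le1 by (simp add: order_antisym)
  qed
  define \<pi> where "\<pi> = embed_pmf r"
  have \<pi>: "pmf \<pi> x = r x" for x
    unfolding \<pi>_def by (rule pmf_embed_pmf[OF r0 total])
  \<comment> \<open>One inequality suffices: both sides are probability laws, so pointwise
    domination forces equality.\<close>
  have "pmf (bind_pmf \<pi> Q) y \<le> pmf \<pi> y" for y
  proof -
    have bind: "(\<integral>\<^sup>+ x. ennreal (pmf q x * pmf (Q x) y) \<partial>count_space UNIV) = ennreal (pmf (bind_pmf q Q) y)" for q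
      by (simp add: ennreal_pmf_bind nn_integral_measure_pmf ennreal_mult)
    have "ennreal (pmf (bind_pmf \<pi> Q) y) \<le> ennreal (r y)"
      unfolding bind[symmetric] \<pi>
    proof (rule fatou)
      show "(\<lambda>n. \<integral>\<^sup>+ x. ennreal (pmf (p n) x * pmf (Q x) y) \<partial>count_space UNIV) \<longlonglongrightarrow> ennreal (r y)"
        using LIMSEQ_Suc[OF r[of y]] unfolding bind p_def law_at_Suc by (intro tendsto_ennrealI)
    qed simp
    then show ?thesis using r0 by (simp add: \<pi>)
  qed
  then have "bind_pmf \<pi> Q = \<pi>"
    using pmf_neq_exists_less[of \<pi> "bind_pmf \<pi> Q"] by (metis leD)
  then show ?thesis ..
qed

lemma doeblin_conv_in_law:
  assumes D: "doeblin Q N \<epsilon> z" and \<pi>: "bind_pmf \<pi> Q = \<pi>"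
  shows "conv_in_law (law_at Q \<mu>) \<pi>"
  unfolding conv_in_law_def
proof (intro allI impI LIMSEQ_I)
  fix f :: "'a \<Rightarrow> real" and e :: real assume "bounded (range f)" "0 < e"
  then obtain B where B: "0 < B" "\<And>x. \<bar>f x\<bar> \<le> B"
    by (auto simp: bounded_pos)
  \<comment> \<open>Affine rescaling to [0, 1], where the contraction estimate applies; it costs the
    factor \<open>2 * B\<close>.\<close>
  define g where "g x = (f x + B) / (2 * B)" for x
  have g: "0 \<le> g x \<and> g x \<le> 1" for x
    using B(1) B(2)[of x] by (auto simp: g_def field_simps abs_le_iff)
  have f: "f = (\<lambda>x. 2 * B * g x - B)"
    using B(1) by (auto simp: g_def field_simps)
  have ig: "integrable (measure_pmf q) g" for q
    by (rule integrable_pmf_bounded[where B=1]) (use g in \<open>auto simp: abs_le_iff intro: order_trans[of _ 0]\<close>)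
  have Ef: "EE q f = 2 * B * EE q g - B" for q
    unfolding f using ig[of q] by (subst Bochner_Integration.integral_diff) auto
  obtain k where k: "(1 - \<epsilon>) ^ k < e / (2 * B)" using doeblin_power_small[OF D, of "e / (2 * B)"] B \<open>0 < e\<close> by auto
  have "norm (EE (law_at Q \<mu> n) f - EE \<pi> f) < e" if "N * k \<le> n" for n
  proof -
    have "\<bar>EE (law_at Q \<mu> n) g - EE \<pi> g\<bar> \<le> (1 - \<epsilon>) ^ k"
      using doeblin_close[OF D g that that, where \<mu>=\<mu> and \<nu>=\<pi>] by (simp add: law_at_invariant[OF \<pi>])
    then have "\<bar>EE (law_at Q \<mu> n) g - EE \<pi> g\<bar> < e / (2 * B)" using k by linarith
    moreover have "EE (law_at Q \<mu> n) f - EE \<pi> f = 2 * B * (EE (law_at Q \<mu> n) g - EE \<pi> g)"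
      by (simp add: Ef algebra_simps)
    ultimately show ?thesis using B(1) by (simp add: abs_mult pos_less_divide_eq mult.commute)
  qed
  then show "\<exists>M. \<forall>n\<ge>M. norm (EE (law_at Q \<mu> n) f - EE \<pi> f) < e" by blast
qed

section \<open>Exponential moments and tail bounds\<close>

lemma hoeffding_pmf:
  fixes f :: "'a \<Rightarrow> real"
  assumes "\<And>x. x \<in> set_pmf p \<Longrightarrow> a \<le> f x \<and> f x \<le> b"
  shows "EE p (\<lambda>x. exp (l * (f x - EE p f))) \<le> exp (l\<^sup>2 * (b - a)\<^sup>2 / 8)"
proof -
  have pos: "EE p (\<lambda>x. exp (l * (f x - EE p f))) \<le> exp (l\<^sup>2 * (b - a)\<^sup>2 / 8)"
    if "l > 0" "\<And>x. x \<in> set_pmf p \<Longrightarrow> a \<le> f x \<and> f x \<le> b" for l a b and f :: "'a \<Rightarrow> real"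
  proof -
    interpret interval_bounded_random_variable "measure_pmf p" f a b
      by unfold_locales (use that(2) in \<open>auto simp: AE_measure_pmf_iff\<close>)
    have bd: "\<bar>exp (l * (f x - EE p f))\<bar> \<le> exp (l * (b - EE p f))" if "x \<in> set_pmf p" for x
      using \<open>l > 0\<close> that \<open>\<And>x. x \<in> set_pmf p \<Longrightarrow> a \<le> f x \<and> f x \<le> b\<close> by simp
    have "ennreal (EE p (\<lambda>x. exp (l * (f x - EE p f)))) = (\<integral>\<^sup>+ x. exp (l * (f x - EE p f)) \<partial>p)"
      by (rule nn_integral_eq_integral[symmetric, OF integrable_pmf_bounded[OF bd]]) auto
    also have "\<dots> \<le> ennreal (exp (l\<^sup>2 * (b - a)\<^sup>2 / 8))"
      by (rule Hoeffdings_lemma_nn_integral) fact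
    finally show ?thesis by simp
  qed
  consider "l > 0" | "l = 0" | "l < 0" by linarith
  then show ?thesis
  proof cases
    \<comment> \<open>Reflection: negative \<open>l\<close> for \<open>f\<close> on
      \<open>[a, b]\<close> is positive \<open>- l\<close> for \<open>- f\<close> on
      \<open>[- b, - a]\<close>. Both signs are needed for a two-sided tail.\<close>
    case 3
    then show ?thesis
      using pos[of "- l" "- b" "\<lambda>x. - f x" "- a"] assms by (simp add: algebra_simps)
  qed (use pos[of l a f b] assms in auto)
qed

text \<open>Markov's inequality for the exponential, at \<open>l = y / V\<close>, which minimises
  l^2 V/2 - l y. The factor 2 is the union bound over the two tails.\<close>

lemma chernoff_optimised:
  fixes X :: "'a \<Rightarrow> real"
  assumes V: "0 < V" and y: "0 < y"
    and bdd: "\<And>x. x \<in> set_pmf p \<Longrightarrow> \<bar>X x\<bar> \<le> B"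
    and mgf: "\<And>l. EE p (\<lambda>x. exp (l * X x)) \<le> exp (l\<^sup>2 * V / 2)"
  shows "measure_pmf.prob p {x. \<bar>X x\<bar> > y} \<le> 2 * exp (- (y\<^sup>2 / (2 * V)))"
proof -
  have one: "measure_pmf.prob p {x. Y x > y} \<le> exp (- (y\<^sup>2 / (2 * V)))"
    if bdd: "\<And>x. x \<in> set_pmf p \<Longrightarrow> \<bar>Y x\<bar> \<le> B"
      and mgf: "EE p (\<lambda>x. exp ((y / V) * Y x)) \<le> exp ((y / V)\<^sup>2 * V / 2)" for Y
  proof -
    have "measure_pmf.prob p {x. Y x > y} = EE p (indicator {x. Y x > y})" by simp
    also have "\<dots> \<le> EE p (\<lambda>x. exp (- (y / V) * y) * exp ((y / V) * Y x))"
    proof (rule expectation_pmf_mono[where B=1 and B'="exp (- (y / V) * y) * exp ((y / V) * B)"])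
      fix x assume x: "x \<in> set_pmf p"
      show "\<bar>exp (- (y / V) * y) * exp ((y / V) * Y x)\<bar> \<le> exp (- (y / V) * y) * exp ((y / V) * B)"
        using bdd[OF x] V y by (auto simp: abs_mult intro!: divide_right_mono mult_left_mono)
      have "0 \<le> (y / V) * (Y x - y)" if "Y x > y"
        using that V y by (intro mult_nonneg_nonneg) auto
      then have "1 \<le> exp (- (y / V) * y) * exp ((y / V) * Y x)" if "Y x > y"
        using that by (simp add: algebra_simps flip: exp_add)
      then show "indicat_real {x. Y x > y} x \<le> exp (- (y / V) * y) * exp ((y / V) * Y x)"
        by (auto simp: indicator_def)
    qed (auto simp: indicator_def)
    also have "\<dots> = exp (- (y / V) * y) * EE p (\<lambda>x. exp ((y / V) * Y x))" by simp
    also have "\<dots> \<le> exp (- (y / V) * y) * exp ((y / V)\<^sup>2 * V / 2)"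
      using mgf by simp
    also have "\<dots> = exp (- (y\<^sup>2 / (2 * V)))"
      using V by (simp flip: exp_add add: power2_eq_square field_simps)
    finally show ?thesis .
  qed
  have "measure_pmf.prob p {x. \<bar>X x\<bar> > y} \<le> measure_pmf.prob p ({x. X x > y} \<union> {x. - X x > y})"
    by (rule measure_pmf.finite_measure_mono) auto
  also have "\<dots> \<le> measure_pmf.prob p {x. X x > y} + measure_pmf.prob p {x. - X x > y}"
    by (rule measure_Un_le) auto
  also have "\<dots> \<le> 2 * exp (- (y\<^sup>2 / (2 * V)))"
    using one[of X] one[of "\<lambda>x. - X x"] mgf[of "y / V"] mgf[of "- (y / V)"] bdd by simp
  finally show ?thesis .
qed

subsection \<open>Additive functionals with bounded increments\<close>

text \<open>Abstracts from the graph: \<open>m\<close> stands for the maximum height, which a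
  dropping never lowers and raises by at most one.\<close>

locale unit_increments =
  fixes K :: "'s \<Rightarrow> 's pmf" and m :: "'s \<Rightarrow> real"
  assumes increment: "s' \<in> set_pmf (K s) \<Longrightarrow> m s \<le> m s' \<and> m s' \<le> m s + 1"
begin

lemma law_range:
  assumes "\<And>s. s \<in> set_pmf \<mu> \<Longrightarrow> a \<le> m s \<and> m s \<le> b"
  shows "s' \<in> set_pmf (law_at K \<mu> n) \<Longrightarrow> a \<le> m s' \<and> m s' \<le> b + real n"
proof (induction n arbitrary: s')
  case (Suc n)
  then obtain s where "s \<in> set_pmf (law_at K \<mu> n)" "s' \<in> set_pmf (K s)"
    by (auto simp: law_at_Suc)
  with Suc.IH[of s] increment[of s' s] show ?case by auto
qed (use assms in auto)

lemma law_return_range: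
  "s' \<in> set_pmf (law_at K (return_pmf s) n) \<Longrightarrow> m s \<le> m s' \<and> m s' \<le> m s + real n"
  by (rule law_range) auto

text \<open>With horizon t, the process \<open>m + drift (t - s)\<close> evaluated at the state at
  time s is the Doob martingale of the final value of \<open>m\<close>.\<close>

definition drift :: "nat \<Rightarrow> 's \<Rightarrow> real" where
  "drift n s = EE (law_at K (return_pmf s) n) m - m s"

lemma drift_bounds: "0 \<le> drift n s" "drift n s \<le> real n"
  using expectation_pmf_between[of "law_at K (return_pmf s) n" "m s" m "m s + real n"]
    law_return_range by (auto simp: drift_def)

lemma expectation_law:
  assumes "\<And>s. s \<in> set_pmf \<mu> \<Longrightarrow> \<bar>m s\<bar> \<le> b"
  shows "EE (law_at K \<mu> n) m = EE \<mu> m + EE \<mu> (drift n)"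
proof -
  have "\<bar>m x\<bar> \<le> b + real n" if "x \<in> set_pmf (law_at K \<mu> n)" for x
    using law_range[of \<mu> "-b" b x n] that assms by (force simp: abs_le_iff)
  then have "EE (law_at K \<mu> n) m = EE \<mu> (\<lambda>s. EE (law_at K (return_pmf s) n) m)"
    by (subst (asm) law_at_bind, subst law_at_bind) (rule expectation_bind_pmf)
  also have "\<dots> = EE \<mu> (\<lambda>s. m s + drift n s)" by (simp add: drift_def)
  also have "\<dots> = EE \<mu> m + EE \<mu> (drift n)"
    by (rule Bochner_Integration.integral_add)
       (rule integrable_pmf_bounded[where B=b], rule assms, assumption,
        rule integrable_pmf_bounded[where B="real n"], simp add: drift_bounds abs_of_nonneg)
  finally show ?thesis .
qed

lemma drift_add:
  "drift (k + n) s = drift k s + EE (law_at K (return_pmf s) k) (drift n)"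
proof -
  have "\<bar>m x\<bar> \<le> \<bar>m s\<bar> + real k" if "x \<in> set_pmf (law_at K (return_pmf s) k)" for x
    using law_return_range[OF that] by linarith
  from expectation_law[OF this, where n=n] show ?thesis
    by (simp add: drift_def law_at_add)
qed

text \<open>The martingale property of \<open>m + drift\<close> over one step, by conditioning on
  that step.\<close>

lemma drift_Suc: "drift (Suc n) s + m s = EE (K s) (\<lambda>s'. m s' + drift n s')"
proof -
  have "\<bar>m x\<bar> \<le> \<bar>m s\<bar> + 1" if "x \<in> set_pmf (K s)" for x
    using increment[OF that] by linarith
  then have "EE (K s) (\<lambda>s'. m s' + drift n s') = EE (K s) m + EE (K s) (drift n)"
    by (intro Bochner_Integration.integral_add integrable_pmf_bounded[where B="\<bar>m s\<bar> + 1"]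
          integrable_pmf_bounded[where B="real n"])
       (auto simp: drift_bounds abs_of_nonneg)
  then show ?thesis
    using drift_add[of 1 n s] by (simp add: drift_def[of "Suc 0"] law_at_Suc bind_return_pmf)
qed

text \<open>Azuma--Hoeffding by induction on the horizon, conditioning on the first step: the
  remaining factor is bounded uniformly in the state reached, so only the first increment has to be
  integrated.\<close>

lemma mgf_return:
  assumes osc: "\<And>n s s'. \<bar>drift n s - drift n s'\<bar> \<le> B"
  shows "EE (law_at K (return_pmf s) n) (\<lambda>x. exp (l * (m x - m s - drift n s)))
           \<le> exp (l\<^sup>2 * (B + 1)\<^sup>2 * real n / 2)"
proof (induction n arbitrary: s)
  case 0
  then show ?case by (simp add: drift_def)
next
  case (Suc n)
  have B: "0 \<le> B" using osc[of n s s] by simp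
  let ?c = "(B + 1)\<^sup>2"
  define Y where "Y x = m x + drift n x" for x
  have EY: "EE (K s) Y = m s + drift (Suc n) s"
    using drift_Suc[of n s] by (simp add: Y_def[abs_def])
  \<comment> \<open>One step changes \<open>m\<close> by at most 1 upwards and
    \<open>drift n\<close> by at most \<open>B\<close> either way, so the increment has range
    \<open>2 * B + 1\<close>.\<close>
  have Y: "m s + drift n s - B \<le> Y x \<and> Y x \<le> m s + drift n s + B + 1" if "x \<in> set_pmf (K s)" for x
    using increment[OF that] osc[of n x s] unfolding Y_def by linarith
  have bd: "\<bar>exp (l * (m x - m s - drift (Suc n) s))\<bar> \<le> exp (\<bar>l\<bar> * real (Suc n))"
    if "x \<in> set_pmf (law_at K (return_pmf s) (Suc n))" for x
  proof -
    have "\<bar>m x - m s - drift (Suc n) s\<bar> \<le> real (Suc n)"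
      using law_return_range[OF that] drift_bounds[of "Suc n" s] by linarith
    then have "\<bar>l\<bar> * \<bar>m x - m s - drift (Suc n) s\<bar> \<le> \<bar>l\<bar> * real (Suc n)"
      by (intro mult_left_mono) auto
    then show ?thesis by (auto simp flip: abs_mult)
  qed
  have "EE (law_at K (return_pmf s) (Suc n)) (\<lambda>x. exp (l * (m x - m s - drift (Suc n) s)))
      = EE (K s) (\<lambda>y. EE (law_at K (return_pmf y) n) (\<lambda>x. exp (l * (m x - m s - drift (Suc n) s))))"
    using bd unfolding law_at_return_Suc by (rule expectation_bind_pmf)
  \<comment> \<open>The exponent splits at the intermediate state \<open>y\<close> into the first
    increment \<open>Y y - EE (K s) Y\<close> and the deviation of the remaining \<open>n\<close>
    steps from \<open>y\<close>.\<close>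
  also have "\<dots> = EE (K s) (\<lambda>y. exp (l * (Y y - EE (K s) Y))
        * EE (law_at K (return_pmf y) n) (\<lambda>x. exp (l * (m x - m y - drift n y))))"
    unfolding EY Y_def integral_mult_right_zero[symmetric] exp_add[symmetric]
    by (simp add: algebra_simps)
  also have "\<dots> \<le> EE (K s) (\<lambda>y. exp (l * (Y y - EE (K s) Y)) * exp (l\<^sup>2 * ?c * real n / 2))"
  proof -
    let ?D = "exp (\<bar>l\<bar> * (\<bar>m s + drift n s\<bar> + B + 1 + \<bar>EE (K s) Y\<bar>)) * exp (l\<^sup>2 * ?c * real n / 2)"
    have e: "exp (l * (Y y - EE (K s) Y)) \<le> exp (\<bar>l\<bar> * (\<bar>m s + drift n s\<bar> + B + 1 + \<bar>EE (K s) Y\<bar>))"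
      if "y \<in> set_pmf (K s)" for y
    proof -
      have "\<bar>l\<bar> * \<bar>Y y - EE (K s) Y\<bar> \<le> \<bar>l\<bar> * (\<bar>m s + drift n s\<bar> + B + 1 + \<bar>EE (K s) Y\<bar>)"
        using Y[OF that] B by (intro mult_left_mono) (auto simp: abs_le_iff)
      then show ?thesis by (auto simp flip: abs_mult)
    qed
    have nn: "0 \<le> EE (law_at K (return_pmf y) n) (\<lambda>x. exp (l * (m x - m y - drift n y)))" for y
      by (rule Bochner_Integration.integral_nonneg) auto
    have le: "exp (l * (Y y - EE (K s) Y)) * EE (law_at K (return_pmf y) n) (\<lambda>x. exp (l * (m x - m y - drift n y)))
        \<le> exp (l * (Y y - EE (K s) Y)) * exp (l\<^sup>2 * ?c * real n / 2)" for y
      by (rule mult_left_mono[OF Suc.IH]) simp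
    have D: "exp (l * (Y y - EE (K s) Y)) * exp (l\<^sup>2 * ?c * real n / 2) \<le> ?D" if "y \<in> set_pmf (K s)" for y
      by (rule mult_right_mono[OF e[OF that]]) simp
    show ?thesis
      by (rule expectation_pmf_mono[where B="?D" and B'="?D"])
         (use order_trans[OF le D] le D nn in \<open>simp_all add: abs_mult del: exp_le_cancel_iff\<close>)
  qed
  also have "\<dots> = EE (K s) (\<lambda>y. exp (l * (Y y - EE (K s) Y))) * exp (l\<^sup>2 * ?c * real n / 2)"
    by simp
  also have "\<dots> \<le> exp (l\<^sup>2 * (2 * B + 1)\<^sup>2 / 8) * exp (l\<^sup>2 * ?c * real n / 2)"
    using hoeffding_pmf[of "K s" "m s + drift n s - B" Y "m s + drift n s + B + 1" l] Y
    by (intro mult_right_mono) (auto simp: algebra_simps)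
  also have "\<dots> \<le> exp (l\<^sup>2 * ?c / 2) * exp (l\<^sup>2 * ?c * real n / 2)"
  proof -
    have "(2 * B + 1)\<^sup>2 \<le> 4 * ?c" using B by (simp add: power2_eq_square algebra_simps)
    then have "l\<^sup>2 * (2 * B + 1)\<^sup>2 \<le> l\<^sup>2 * (4 * ?c)" by (intro mult_left_mono) auto
    then show ?thesis by simp
  qed
  also have "\<dots> = exp (l\<^sup>2 * ?c * real (Suc n) / 2)"
    by (simp add: field_simps flip: exp_add)
  finally show ?case .
qed

text \<open>As \<open>m\<close> is constant on the support of \<open>\<mu>\<close>, the random start
  enters only through \<open>drift n\<close>. This increment has range \<open>2 * B\<close>, fits
  under the same constant, and turns \<open>real n\<close> into \<open>real n + 1\<close>.\<close>

lemma mgf_law: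
  assumes osc: "\<And>n s s'. \<bar>drift n s - drift n s'\<bar> \<le> B"
    and \<mu>: "\<And>s. s \<in> set_pmf \<mu> \<Longrightarrow> m s = m0"
  shows "EE (law_at K \<mu> n) (\<lambda>x. exp (l * (m x - EE (law_at K \<mu> n) m)))
           \<le> exp (l\<^sup>2 * ((B + 1)\<^sup>2 * (real n + 1)) / 2)"
proof -
  have B: "0 \<le> B" using osc[of n undefined undefined] by simp
  let ?c = "(B + 1)\<^sup>2" and ?M = "EE (law_at K \<mu> n) m" and ?u = "EE \<mu> (drift n)"
  have "?M = EE \<mu> m + ?u"
    using \<mu> by (intro expectation_law[of _ "\<bar>m0\<bar>"]) auto
  moreover have "EE \<mu> m = EE \<mu> (\<lambda>_. m0)"
    using \<mu> by (intro expectation_pmf_cong) auto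
  ultimately have M: "?M = m0 + ?u" by simp
  have u: "0 \<le> ?u" "?u \<le> real n"
    using expectation_pmf_between[of \<mu> 0 "drift n" "real n"] drift_bounds by auto
  have bd: "\<bar>exp (l * (m x - ?M))\<bar> \<le> exp (\<bar>l\<bar> * real n)" if "x \<in> set_pmf (law_at K \<mu> n)" for x
  proof -
    have "m0 \<le> m x \<and> m x \<le> m0 + real n" using that \<mu> by (intro law_range) auto
    then have "\<bar>m x - ?M\<bar> \<le> real n" using u M by linarith
    then have "\<bar>l\<bar> * \<bar>m x - ?M\<bar> \<le> \<bar>l\<bar> * real n" by (intro mult_left_mono) auto
    then show ?thesis by (auto simp flip: abs_mult)
  qed
  have "EE (law_at K \<mu> n) (\<lambda>x. exp (l * (m x - ?M)))
      = EE \<mu> (\<lambda>s. EE (law_at K (return_pmf s) n) (\<lambda>x. exp (l * (m x - ?M))))"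
    using bd by (subst law_at_bind, subst (asm) law_at_bind) (rule expectation_bind_pmf)
  also have "\<dots> = EE \<mu> (\<lambda>s. exp (l * (drift n s - ?u))
        * EE (law_at K (return_pmf s) n) (\<lambda>x. exp (l * (m x - m s - drift n s))))"
    unfolding M integral_mult_right_zero[symmetric] exp_add[symmetric]
    by (intro expectation_pmf_cong) (simp add: \<mu> algebra_simps)
  also have "\<dots> \<le> EE \<mu> (\<lambda>s. exp (l * (drift n s - ?u)) * exp (l\<^sup>2 * ?c * real n / 2))"
  proof -
    let ?D = "exp (\<bar>l\<bar> * real n) * exp (l\<^sup>2 * ?c * real n / 2)"
    have e: "exp (l * (drift n y - ?u)) \<le> exp (\<bar>l\<bar> * real n)" for y
    proof -
      have "\<bar>l\<bar> * \<bar>drift n y - ?u\<bar> \<le> \<bar>l\<bar> * real n"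
        using drift_bounds[of n y] u by (intro mult_left_mono) (auto simp: abs_le_iff)
      then show ?thesis by (auto simp flip: abs_mult)
    qed
    have nn: "0 \<le> EE (law_at K (return_pmf y) n) (\<lambda>x. exp (l * (m x - m y - drift n y)))" for y
      by (rule Bochner_Integration.integral_nonneg) auto
    have le: "exp (l * (drift n y - ?u)) * EE (law_at K (return_pmf y) n) (\<lambda>x. exp (l * (m x - m y - drift n y)))
        \<le> exp (l * (drift n y - ?u)) * exp (l\<^sup>2 * ?c * real n / 2)" for y
      by (rule mult_left_mono[OF mgf_return[OF osc]]) simp
    have D: "exp (l * (drift n y - ?u)) * exp (l\<^sup>2 * ?c * real n / 2) \<le> ?D" for y
      by (rule mult_right_mono[OF e]) simp
    show ?thesis
      by (rule expectation_pmf_mono[where B="?D" and B'="?D"])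
         (use order_trans[OF le D] le D nn in \<open>simp_all add: abs_mult del: exp_le_cancel_iff\<close>)
  qed
  also have "\<dots> = EE \<mu> (\<lambda>s. exp (l * (drift n s - ?u))) * exp (l\<^sup>2 * ?c * real n / 2)"
    by simp
  also have "\<dots> \<le> exp (l\<^sup>2 * (2 * B)\<^sup>2 / 8) * exp (l\<^sup>2 * ?c * real n / 2)"
  proof -
    obtain s0 :: 's where True by blast
    have "drift n s0 - B \<le> drift n s \<and> drift n s \<le> drift n s0 + B" for s
      using osc[of n s s0] by linarith
    from hoeffding_pmf[of \<mu> "drift n s0 - B" "drift n" "drift n s0 + B" l, OF this]
    show ?thesis by (intro mult_right_mono) (auto simp: algebra_simps)
  qed
  also have "\<dots> \<le> exp (l\<^sup>2 * ?c / 2) * exp (l\<^sup>2 * ?c * real n / 2)"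
  proof -
    have "(2 * B)\<^sup>2 \<le> 4 * ?c" using B by (simp add: power2_eq_square algebra_simps)
    then have "l\<^sup>2 * (2 * B)\<^sup>2 \<le> l\<^sup>2 * (4 * ?c)" by (intro mult_left_mono) auto
    then show ?thesis by simp
  qed
  also have "\<dots> = exp (l\<^sup>2 * (?c * (real n + 1)) / 2)"
    by (simp add: field_simps flip: exp_add)
  finally show ?thesis .
qed

lemma concentration:
  assumes osc: "\<And>n s s'. \<bar>drift n s - drift n s'\<bar> \<le> B"
    and \<mu>: "\<And>s. s \<in> set_pmf \<mu> \<Longrightarrow> m s = m0" and y: "0 < y"
  shows "measure_pmf.prob (law_at K \<mu> n) {x. \<bar>m x - EE (law_at K \<mu> n) m\<bar> > y}
           \<le> 2 * exp (- (1 / (2 * (B + 1)\<^sup>2) * y\<^sup>2 / (2 * real n)))"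
proof (cases "n = 0")
  case True
  \<comment> \<open>Division by zero yields zero, so at time 0 the right-hand side is 2 and the
    bound is trivial.\<close>
  then show ?thesis
    by (auto intro: order_trans[OF measure_pmf.prob_le_1])
next
  case False
  have B: "0 \<le> B" using osc[of n undefined undefined] by simp
  define V where "V = (B + 1)\<^sup>2 * (real n + 1)"
  have V: "0 < V" "V \<le> (B + 1)\<^sup>2 * (2 * real n)"
    using B False unfolding V_def by (auto intro!: mult_pos_pos mult_left_mono)
  have "\<bar>m x - EE (law_at K \<mu> n) m\<bar> \<le> \<bar>m0\<bar> + real n + \<bar>EE (law_at K \<mu> n) m\<bar>"
    if "x \<in> set_pmf (law_at K \<mu> n)" for x
  proof -
    have "m0 \<le> m x \<and> m x \<le> m0 + real n" using that \<mu> by (intro law_range) auto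
    then show ?thesis by linarith
  qed
  then have "measure_pmf.prob (law_at K \<mu> n) {x. \<bar>m x - EE (law_at K \<mu> n) m\<bar> > y}
      \<le> 2 * exp (- (y\<^sup>2 / (2 * V)))"
    using mgf_law[OF osc \<mu>] V by (intro chernoff_optimised[OF V(1) y]) (auto simp: V_def)
  also have "\<dots> \<le> 2 * exp (- (1 / (2 * (B + 1)\<^sup>2) * y\<^sup>2 / (2 * real n)))"
  proof -
    have "y\<^sup>2 / ((B + 1)\<^sup>2 * (2 * real n) * 2) \<le> y\<^sup>2 / (2 * V)"
      using V by (intro divide_left_mono) (auto simp: mult_ac intro!: mult_pos_pos)
    then show ?thesis by (simp add: mult_ac)
  qed
  finally show ?thesis .
qed

text \<open>\<open>drift (N + k)\<close> is \<open>drift N\<close>, which lies between 0 and N, plus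
  an average of \<open>drift k\<close>, whose oscillation the minorisation contracts to (1 -
  \<epsilon>) N/\<epsilon> = N/\<epsilon> - N. The sum is again N/\<epsilon>, so the bound does not
  grow with the horizon.\<close>

lemma drift_oscillation:
  assumes D: "doeblin Q N \<epsilon> z"
    and PQ: "\<And>s. map_pmf P (K s) = Q (P s)" and P: "\<And>n s. drift n (P s) = drift n s"
  shows "\<bar>drift n s - drift n s'\<bar> \<le> real N / \<epsilon>"
proof (induction n arbitrary: s s' rule: less_induct)
  case (less n)
  have \<epsilon>: "0 < N" "0 < \<epsilon>" "\<epsilon> \<le> 1" "\<And>s. \<epsilon> \<le> pmf (law_at Q (return_pmf s) N) z"
    using D by (auto simp: doeblin_def)
  have NN: "real N \<le> real N / \<epsilon>" using \<epsilon> by (simp add: field_simps)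
  show ?case
  proof (cases "n < N")
    case True
    then show ?thesis using drift_bounds[of n s] drift_bounds[of n s'] NN by linarith
  next
    case False
    define k where "k = n - N"
    have k: "n = N + k" "k < n" using False \<epsilon> by (auto simp: k_def)
    define a where "a = Inf (range (drift k))"
    define b where "b = a + real N / \<epsilon>"
    have a: "a \<le> drift k x" for x
      unfolding a_def by (rule cINF_lower) (auto intro!: bdd_belowI[of _ 0] drift_bounds)
    have b: "drift k x \<le> b" for x
    proof -
      have "drift k x - real N / \<epsilon> \<le> a"
        unfolding a_def using less[OF k(2)] by (intro cINF_greatest) (auto simp: abs_le_iff algebra_simps)
      then show ?thesis by (simp add: b_def)
    qed
    \<comment> \<open>The minorisation holds for the projected chain \<open>Q\<close>; as
      \<open>P\<close> leaves \<open>drift k\<close> unchanged, the expectation can be taken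
      there.\<close>
    have step: "EE (law_at K (return_pmf s) N) (drift k) = EE (law_at Q (return_pmf (P s)) N) (drift k)" for s
    proof -
      have "EE (law_at Q (return_pmf (P s)) N) (drift k) = EE (map_pmf P (law_at K (return_pmf s) N)) (drift k)"
        using map_law_at[of P K Q "return_pmf s" N, OF PQ] by simp
      then show ?thesis by (simp add: P)
    qed
    have E: "a + \<epsilon> * (drift k z - a) \<le> EE (law_at K (return_pmf s) N) (drift k)"
         "EE (law_at K (return_pmf s) N) (drift k) \<le> b - \<epsilon> * (b - drift k z)" for s
      unfolding step using \<epsilon> a b by (auto intro!: doeblin_step)
    have "b - \<epsilon> * (b - drift k z) - (a + \<epsilon> * (drift k z - a)) = real N / \<epsilon> - real N"
      using \<epsilon> by (simp add: b_def field_simps)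
    then show ?thesis
      using E[of s] E[of s'] drift_bounds[of N s] drift_bounds[of N s']
      unfolding k(1) drift_add by linarith
  qed
qed

end

section \<open>Monotonicity and translation invariance of a single dropping\<close>

lemma T_op_same: "T_op E i h i = Max (h ` {k. k = i \<or> E k i}) + 1"
  by (simp add: T_op_def)

lemma T_op_other: "j \<noteq> i \<Longrightarrow> T_op E i h j = h j"
  by (simp add: T_op_def)

lemma T_op_ge_neighbour:
  assumes "k = i \<or> E k i"
  shows "h k + 1 \<le> T_op E i h i"
proof -
  have "h k \<le> Max (h ` {k. k = i \<or> E k i})" using assms by (intro Max_ge) auto
  then show ?thesis by (simp add: T_op_same)
qed

lemma T_op_increasing: "h j \<le> T_op E i h j"
  using T_op_ge_neighbour[where k=i and i=i and E=E and h=h] by (cases "j = i") (auto simp: T_op_other)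

lemma mV_ge: "h j \<le> mV h"
  by (simp add: mV_def)

lemma mV_attained: "\<exists>j. mV h = h j"
proof -
  have "Max (range h) \<in> range h" by (rule Max_in) auto
  then show ?thesis unfolding mV_def by (rule rangeE) blast
qed

lemma mV_leI: "(\<And>j. h j \<le> c) \<Longrightarrow> mV h \<le> c"
  using mV_attained[of h] by metis

lemma T_op_le: 
  assumes "\<And>k. h k \<le> c"
  shows "T_op E i h j \<le> c + 1"
proof (cases "j = i")
  case True
  have "Max (h ` {k. k = i \<or> E k i}) \<le> c" using assms by (subst Max_le_iff) auto
  then show ?thesis using True by (simp add: T_op_same)
next
  case False
  then show ?thesis using assms[of j] by (simp add: T_op_other)
qed

lemma mV_T_op: "mV h \<le> mV (T_op E i h)" "mV (T_op E i h) \<le> mV h + 1"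
proof -
  show "mV h \<le> mV (T_op E i h)"
    by (rule mV_leI) (meson T_op_increasing mV_ge order_trans)
  show "mV (T_op E i h) \<le> mV h + 1"
    by (rule mV_leI, rule T_op_le, rule mV_ge)
qed

definition translate :: "int \<Rightarrow> ('v::finite \<Rightarrow> int) \<Rightarrow> 'v \<Rightarrow> int" where
  "translate c h = (\<lambda>j. h j + c)"

lemma Max_plus_int:
  fixes h :: "'v::finite \<Rightarrow> int"
  assumes "S \<noteq> {}"
  shows "Max ((\<lambda>j. h j + c) ` S) = Max (h ` S) + c"
  using Max_add_commute[of S h c] assms by simp

lemma mV_translate: "mV (translate c h) = mV h + c"
  unfolding mV_def translate_def by (rule Max_plus_int) simp

lemma T_op_translate: "T_op E i (translate c h) = translate c (T_op E i h)"
proof -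
  have "{k. k = i \<or> E k i} \<noteq> {}" by auto
  from Max_plus_int[OF this, of h c] show ?thesis
    by (auto simp: T_op_def translate_def fun_eq_iff)
qed

lemma profile_eq_translate: "profile h = translate (- mV h) h"
  by (simp add: profile_def translate_def)

lemma profile_translate: "profile (translate c h) = profile h"
  by (simp add: profile_def mV_translate) (simp add: translate_def)

lemma mV_profile: "mV (profile h) = 0"
  by (simp add: profile_eq_translate[of h] mV_translate)

text \<open>Droppings commute with vertical shifts, hence the next profile depends on the current
  profile alone: the reason why profiles evolve as a Markov chain.\<close>

lemma profile_T_op: "profile (T_op E i (profile h)) = profile (T_op E i h)"
  by (simp add: profile_eq_translate[of h] T_op_translate profile_translate)

subsection \<open>Words of droppings\<close>

definition drop_word :: "('v::finite \<Rightarrow> 'v \<Rightarrow> bool) \<Rightarrow> 'v list \<Rightarrow> ('v \<Rightarrow> int) \<Rightarrow> 'v \<Rightarrow> int" where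
  "drop_word E w = fold (T_op E) w"

lemma drop_word_simps [simp]:
  "drop_word E [] h = h"
  "drop_word E (i # w) h = drop_word E w (T_op E i h)"
  "drop_word E (w @ w') h = drop_word E w' (drop_word E w h)"
  by (simp_all add: drop_word_def)

lemma drop_word_increasing: "h j \<le> drop_word E w h j"
  by (induction w arbitrary: h) (auto intro: order_trans[OF T_op_increasing])

lemma drop_word_le: "(\<And>k. h k \<le> c) \<Longrightarrow> drop_word E w h j \<le> c + int (length w)"
proof (induction w arbitrary: h c)
  case (Cons i w)
  have "drop_word E w (T_op E i h) j \<le> (c + 1) + int (length w)"
    by (rule Cons.IH) (rule T_op_le[OF Cons.prems])
  then show ?case by simp
qed simp

lemma drop_word_translate: "drop_word E w (translate c h) = translate c (drop_word E w h)"
  by (induction w arbitrary: h) (auto simp: T_op_translate)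

lemma drop_word_replicate:
  "h i + int n \<le> drop_word E (replicate n i) h i"
  "j \<noteq> i \<Longrightarrow> drop_word E (replicate n i) h j = h j"
proof (induction n arbitrary: h)
  case (Suc n)
  { case 1 show ?case using Suc.IH(1)[where h="T_op E i h"] T_op_ge_neighbour[where k=i and i=i and E=E and h=h] by simp }
  { case 2 then show ?case using Suc.IH(2)[where h="T_op E i h"] by (simp add: T_op_other) }
qed auto

text \<open>Heights below \<open>c\<close> can influence the landing height only by putting it at or
  below \<open>c + 1\<close>. The floor has to rise by one for this reason.\<close>

lemma T_op_truncate:
  "max (T_op E i h j) (c + 1) = max (T_op E i (\<lambda>j. max (h j) c) j) (c + 1)"
proof (cases "j = i")
  case True
  let ?S = "{k. k = i \<or> E k i}"
  have "Max ((\<lambda>k. max (h k) c) ` ?S) = max (Max (h ` ?S)) c"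
  proof (rule antisym)
    show "Max ((\<lambda>k. max (h k) c) ` ?S) \<le> max (Max (h ` ?S)) c"
      by (subst Max_le_iff) (auto intro!: max.mono Max_ge simp del: max.bounded_iff)
    have "h k \<le> Max ((\<lambda>k. max (h k) c) ` ?S)" if "k \<in> ?S" for k
      by (rule order_trans[OF _ Max_ge[of _ "max (h k) c"]]) (use that in auto)
    moreover have "c \<le> Max ((\<lambda>k. max (h k) c) ` ?S)"
      by (rule order_trans[OF _ Max_ge[of _ "max (h i) c"]]) auto
    ultimately show "max (Max (h ` ?S)) c \<le> Max ((\<lambda>k. max (h k) c) ` ?S)"
      by (subst max.bounded_iff, subst Max_le_iff) auto
  qed
  then show ?thesis using True by (simp add: T_op_same)
qed (auto simp: T_op_other)

lemma drop_word_truncate: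
  assumes "\<And>j. max (h j) c = max (h' j) c"
  shows "max (drop_word E w h j) (c + int (length w)) = max (drop_word E w h' j) (c + int (length w))"
  using assms
proof (induction w arbitrary: h h' c)
  case (Cons i w)
  have "max (T_op E i h j) (c + 1) = max (T_op E i h' j) (c + 1)" for j
    using T_op_truncate[of E i h j c] T_op_truncate[of E i h' j c] Cons.prems by simp
  from Cons.IH[of "T_op E i h" "c + 1" "T_op E i h'", OF this] show ?case by (simp add: algebra_simps)
qed simp

subsection \<open>Words followed by the driving chain\<close>

text \<open>The word lists the vertices where particles fall; the starting position \<open>v\<close>
  is not among them, since no particle falls there at time 0.\<close>

fun driven_path :: "('v \<Rightarrow> 'v pmf) \<Rightarrow> 'v \<Rightarrow> 'v list \<Rightarrow> 'v \<Rightarrow> bool" where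
  "driven_path A v [] v' \<longleftrightarrow> v = v'"
| "driven_path A v (x # w) v' \<longleftrightarrow> x \<in> set_pmf (A v) \<and> driven_path A x w v'"

lemma driven_path_append: "driven_path A v w u \<Longrightarrow> driven_path A u w' v' \<Longrightarrow> driven_path A v (w @ w') v'"
  by (induction w arbitrary: v) auto

lemma driven_path_replicate: "lazy_kernel A \<Longrightarrow> driven_path A v (replicate n v) v"
  by (induction n) (auto simp: lazy_kernel_def pmf_positive_iff)

lemma driven_path_concat_replicate: "driven_path A v w v \<Longrightarrow> driven_path A v (concat (replicate n w)) v"
  by (induction n) (auto intro: driven_path_append)

lemma driven_path_of_law_at: "v' \<in> set_pmf (law_at A (return_pmf v) s) \<Longrightarrow> \<exists>w. driven_path A v w v'"
proof (induction s arbitrary: v')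
  case 0
  then show ?case by (auto intro: exI[of _ "[]"])
next
  case (Suc s)
  then obtain u where u: "u \<in> set_pmf (law_at A (return_pmf v) s)" "v' \<in> set_pmf (A u)"
    by (auto simp: law_at_Suc)
  then obtain w where "driven_path A v w u" using Suc.IH by blast
  then show ?case using u by (intro exI[of _ "w @ [v']"]) (auto intro: driven_path_append)
qed

lemma driven_path_exists:
  assumes "irreducible_kernel A"
  shows "\<exists>w. driven_path A v w v'"
proof (cases "v = v'")
  case True
  then show ?thesis by (auto intro: exI[of _ "[]"])
next
  case False
  then show ?thesis
    using assms driven_path_of_law_at unfolding irreducible_kernel_def pmf_positive_iff by metis
qed

text \<open>Waiting at \<open>v0\<close>, possible by laziness, pads all paths to the length of the
  longest one. Doeblin's condition needs this common time.\<close>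

lemma driven_path_uniform_length:
  fixes A :: "'v::finite \<Rightarrow> 'v pmf"
  assumes "irreducible_kernel A" "lazy_kernel A"
  obtains L where "\<And>v. \<exists>w. length w = L \<and> driven_path A v w v0"
proof -
  obtain f where f: "\<And>v. driven_path A v (f v) v0" using driven_path_exists[OF assms(1), of _ v0] by metis
  define L where "L = Max (range (length \<circ> f))"
  have "length (f v) \<le> L" for v
    unfolding L_def by (rule Max_ge) auto
  then have "length (f v @ replicate (L - length (f v)) v0) = L" for v
    by simp
  moreover have "driven_path A v (f v @ replicate (L - length (f v)) v0) v0" for v
    using f driven_path_replicate[OF assms(2)] by (rule driven_path_append)
  ultimately show ?thesis using that by blast
qed

lemma covering_cycle:
  fixes A :: "'v::finite \<Rightarrow> 'v pmf"
  assumes "irreducible_kernel A" "lazy_kernel A"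
  obtains w where "driven_path A v0 w v0" "set w = UNIV"
proof -
  have "\<exists>w. driven_path A v0 w v0 \<and> S \<subseteq> set w" if "finite S" for S
    using that
  proof (induction S)
    case (insert x S)
    then obtain w where w: "driven_path A v0 w v0" "S \<subseteq> set w" by blast
    obtain s where s: "driven_path A v0 s x" using driven_path_exists[OF assms(1)] by blast
    obtain r where r: "driven_path A x r v0" using driven_path_exists[OF assms(1)] by blast
    \<comment> \<open>For \<open>x = v0\<close> the connecting paths may be empty; one lazy step
      puts \<open>x\<close> into the word in every case.\<close>
    have x: "driven_path A x [x] x" using driven_path_replicate[OF assms(2), of x 1] by simp
    show ?case
      using driven_path_append[OF w(1) driven_path_append[OF s driven_path_append[OF x r]]] w(2)
      by (intro exI[of _ "w @ s @ [x] @ r"]) auto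
  qed (auto intro: exI[of _ "[]"])
  from this[of UNIV] show ?thesis using that by auto
qed

lemma drop_word_spread:
  assumes "E k j" "j \<in> set w" "a \<le> h k"
  shows "a \<le> drop_word E w h j"
proof -
  obtain w1 w2 where w: "w = w1 @ j # w2" using assms(2) by (meson split_list)
  have "a \<le> drop_word E w1 h k" using assms(3) drop_word_increasing by (rule order_trans)
  also have "\<dots> \<le> T_op E j (drop_word E w1 h) j"
    using T_op_ge_neighbour[where k=k and i=j and E=E and h="drop_word E w1 h"] assms(1) by auto
  also have "\<dots> \<le> drop_word E w h j"
    unfolding w by (simp add: drop_word_increasing)
  finally show ?thesis .
qed

lemma drop_word_concat_replicate_mono:
  assumes "n \<le> m"
  shows "drop_word E (concat (replicate n w)) h j \<le> drop_word E (concat (replicate m w)) h j"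
proof -
  have "replicate m w = replicate n w @ replicate (m - n) w"
    using assms by (simp flip: replicate_add)
  then show ?thesis by (simp add: drop_word_increasing)
qed

text \<open>Each pass through all vertices carries a lower bound across one more edge, so a path
  from \<open>k\<close> to \<open>j\<close> of n edges needs n passes. Finitely many pairs give a
  common number.\<close>

lemma drop_word_cover:
  fixes E :: "'v::finite \<Rightarrow> 'v \<Rightarrow> bool"
  assumes conn: "connected_graph E" and w: "set w = UNIV"
  obtains n where "0 < n" "\<And>h j. mV h \<le> drop_word E (concat (replicate n w)) h j"
proof -
  define P where "P n k j \<longleftrightarrow> (\<forall>h. h k \<le> drop_word E (concat (replicate n w)) h j)" for n k j
  have "\<exists>n. P n k j" if "E\<^sup>*\<^sup>* k j" for k j
    using that
  proof (induction rule: rtranclp_induct)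
    case base
    then show ?case by (auto simp: P_def intro: exI[of _ 0])
  next
    case (step y z)
    then obtain n where n: "P n k y" by blast
    have "P (Suc n) k z"
      unfolding P_def
    proof
      fix h
      have "h k \<le> drop_word E w (drop_word E (concat (replicate n w)) h) z"
        by (rule drop_word_spread[where k=y]) (use n step w in \<open>auto simp: P_def\<close>)
      also have "\<dots> = drop_word E (concat (replicate (Suc n) w)) h z"
        by (simp flip: replicate_append_same)
      finally show "h k \<le> drop_word E (concat (replicate (Suc n) w)) h z" .
    qed
    then show ?case by blast
  qed
  then obtain f where f: "\<And>k j. P (f k j) k j"
    using conn unfolding connected_graph_def by metis
  \<comment> \<open>The successor makes \<open>n\<close> positive, so that the repeated word is not
    empty.\<close>
  define n where "n = Suc (Max (range (case_prod f)))"
  have "f k j \<le> n" for k j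
    unfolding n_def by (rule le_SucI, rule Max_ge) (auto intro: rev_image_eqI[of "(k, j)"])
  then have n: "P n k j" for k j
    using f[of k j] drop_word_concat_replicate_mono[of "f k j" n E w]
    unfolding P_def by (meson order_trans)
  show ?thesis
  proof (rule that[of n])
    fix h :: "'v \<Rightarrow> int" and j
    obtain k where "mV h = h k" using mV_attained by metis
    then show "mV h \<le> drop_word E (concat (replicate n w)) h j"
      using n[of k j] by (simp add: P_def)
  qed (simp add: n_def)
qed

text \<open>After one pass of \<open>w\<close> all heights lie within \<open>length w\<close> of the maximum, so the droppings at
  \<open>v\<close> raise \<open>v\<close> above all other vertices by at least \<open>length w\<close>. The second pass then erases the
  other heights.\<close>

lemma profile_coalesces:
  fixes E :: "'v::finite \<Rightarrow> 'v \<Rightarrow> bool"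
  assumes w: "\<And>h j. mV h \<le> drop_word E w h j"
  shows "profile (drop_word E (w @ replicate (2 * length w) v @ w) h)
       = profile (drop_word E w (\<lambda>j. if j = v then 0 else - int (length w)))"
proof -
  let ?n = "int (length w)" and ?g = "\<lambda>j. if j = v then 0 else - int (length w)"
  define h1 where "h1 = drop_word E w h"
  define h2 where "h2 = drop_word E (replicate (2 * length w) v) h1"
  define b where "b = h2 v"
  have h1: "mV h \<le> h1 j" "h1 j \<le> mV h + ?n" for j
    unfolding h1_def by (rule w, rule drop_word_le, rule mV_ge)
  have "mV h + 2 * ?n \<le> b"
    using drop_word_replicate(1)[of h1 v "2 * length w" E] h1(1)[of v] by (simp add: b_def h2_def)
  moreover have "h2 j = h1 j" if "j \<noteq> v" for j
    unfolding h2_def using that by (rule drop_word_replicate(2))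
  \<comment> \<open>Off \<open>v\<close> both heights are at most \<open>b - ?n\<close>: the first
    pass ends at most \<open>?n\<close> above the old maximum, and \<open>2 * length w\<close>
    droppings at \<open>v\<close> leave a gap of \<open>?n\<close>. This is exactly the rise of the
    floor during the second pass.\<close>
  ultimately have "max (h2 j) (b - ?n) = max (translate b ?g j) (b - ?n)" for j
    using h1(2)[of j] by (cases "j = v") (auto simp: translate_def b_def)
  then have eq: "max (drop_word E w h2 j) b = max (drop_word E w (translate b ?g) j) b" for j
    using drop_word_truncate[of h2 "b - ?n" "translate b ?g" E w j] by simp
  have "b \<le> drop_word E w h2 j" for j
    unfolding b_def by (rule order_trans[OF mV_ge w])
  moreover have "b \<le> drop_word E w (translate b ?g) j" for j
    using order_trans[OF mV_ge w, of "translate b ?g" v j] by (simp add: translate_def)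
  ultimately have "drop_word E w h2 = translate b (drop_word E w ?g)"
    using eq by (simp add: fun_eq_iff max_absorb1 drop_word_translate)
  then show ?thesis by (simp add: h1_def h2_def profile_translate)
qed

section \<open>The chain of relative states and its minorisation\<close>

lemma pmf_bind_ge: "pmf p x * pmf (f x) y \<le> pmf (bind_pmf p f) y"
proof -
  have "pmf p x * pmf (f x) y = EE p (\<lambda>u. pmf (f x) y * indicator {x} u)"
    by (simp add: measure_pmf_single)
  also have "\<dots> \<le> EE p (\<lambda>u. pmf (f u) y)"
    by (rule expectation_pmf_mono[where B=1 and B'=1])
       (auto simp: indicator_def pmf_le_1)
  finally show ?thesis by (simp add: pmf_bind)
qed

lemma pmf_map_ge: "pmf p x \<le> pmf (map_pmf f p) (f x)"
  by (subst pmf_map, subst measure_pmf_single[symmetric], rule measure_pmf.finite_measure_mono) auto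

definition relative :: "('v::finite \<Rightarrow> int) \<times> 'v \<Rightarrow> ('v \<Rightarrow> int) \<times> 'v" where
  "relative s = (profile (fst s), snd s)"

definition Q_mc :: "('v \<Rightarrow> 'v \<Rightarrow> bool) \<Rightarrow> ('v \<Rightarrow> 'v pmf) \<Rightarrow> ('v::finite \<Rightarrow> int) \<times> 'v \<Rightarrow> (('v \<Rightarrow> int) \<times> 'v) pmf" where
  "Q_mc E A s = map_pmf relative (K_mc E A s)"

lemma map_relative_K_mc: "map_pmf relative (K_mc E A s) = Q_mc E A (relative s)"
  by (simp add: Q_mc_def K_mc_def relative_def map_pmf_comp profile_T_op)

lemma invariant_mc_iff: "invariant_mc E A \<pi> \<longleftrightarrow> bind_pmf \<pi> (Q_mc E A) = \<pi>"
  unfolding invariant_mc_def Q_mc_def[abs_def] map_bind_pmf relative_def[abs_def] ..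

lemma map_relative_law_at:
  "map_pmf relative (law_at (K_mc E A) \<mu> t) = law_at (Q_mc E A) (map_pmf relative \<mu>) t"
  by (rule map_law_at) (rule map_relative_K_mc)

text \<open>The first step of \<open>Q_mc\<close> normalises its configuration, so from then on
  \<open>s\<close> and \<open>relative s\<close> are indistinguishable. This extends the
  minorisation to starts that are not normalised.\<close>

lemma law_at_Q_mc_relative:
  assumes "0 < n"
  shows "law_at (Q_mc E A) (return_pmf s) n = law_at (Q_mc E A) (return_pmf (relative s)) n"
proof -
  obtain k where n: "n = Suc k" using assms gr0_implies_Suc by blast
  show ?thesis
    unfolding n law_at_return_Suc by (simp add: map_relative_K_mc[symmetric] Q_mc_def[of E A s])
qed

lemma pmf_law_at_driven_path:
  assumes \<delta>: "\<And>v v'. v' \<in> set_pmf (A v) \<Longrightarrow> \<delta> \<le> pmf (A v) v'" "0 \<le> \<delta>"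
    and w: "driven_path A v w v'"
  shows "\<delta> ^ length w \<le> pmf (law_at (K_mc E A) (return_pmf (h, v)) (length w)) (drop_word E w h, v')"
  using w
proof (induction w arbitrary: h v)
  case (Cons x w)
  let ?s = "(T_op E x h, x)"
  have "\<delta> \<le> pmf (A v) x" using \<delta>(1) Cons.prems by simp
  also have "\<dots> \<le> pmf (K_mc E A (h, v)) ?s"
    using pmf_map_ge[of "A v" x "\<lambda>x. (T_op E x h, x)"] by (simp add: K_mc_def)
  finally have "\<delta> * \<delta> ^ length w \<le> pmf (K_mc E A (h, v)) ?s
      * pmf (law_at (K_mc E A) (return_pmf ?s) (length w)) (drop_word E w (T_op E x h), v')"
    using Cons \<delta>(2) by (intro mult_mono) auto
  also have "\<dots> \<le> pmf (law_at (K_mc E A) (return_pmf (h, v)) (Suc (length w))) (drop_word E w (T_op E x h), v')"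
    unfolding law_at_return_Suc by (rule pmf_bind_ge)
  finally show ?case by simp
qed auto

lemma kernel_positive_lower_bound:
  fixes A :: "'v::finite \<Rightarrow> 'v pmf"
  obtains \<delta> where "0 < \<delta>" "\<delta> \<le> 1" "\<And>v v'. v' \<in> set_pmf (A v) \<Longrightarrow> \<delta> \<le> pmf (A v) v'"
proof -
  \<comment> \<open>Inserting 1 ensures that the minimum is at most 1, hence so is
    \<open>\<epsilon>\<close>, a power of it.\<close>
  define S where "S = insert 1 ((\<lambda>(v, v'). pmf (A v) v') ` {(v, v'). v' \<in> set_pmf (A v)})"
  have S: "finite S" "S \<noteq> {}" unfolding S_def by auto
  show ?thesis
  proof (rule that[of "Min S"])
    show "0 < Min S" using S by (subst Min_gr_iff) (auto simp: S_def pmf_positive_iff)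
    show "Min S \<le> 1" using S by (intro Min_le) (auto simp: S_def)
    fix v v' assume "v' \<in> set_pmf (A v)"
    then show "Min S \<le> pmf (A v) v'" using S by (intro Min_le) (auto simp: S_def)
  qed
qed

lemma doeblin_Q_mc:
  fixes E :: "'v::finite \<Rightarrow> 'v \<Rightarrow> bool"
  assumes conn: "connected_graph E" and A: "irreducible_kernel A" "lazy_kernel A"
  obtains N \<epsilon> z where "doeblin (Q_mc E A) N \<epsilon> z"
proof -
  define v0 :: 'v where "v0 = undefined"
  obtain L where L: "\<And>v. \<exists>w. length w = L \<and> driven_path A v w v0"
    using driven_path_uniform_length[OF A] by blast
  obtain c where c: "driven_path A v0 c v0" "set c = UNIV" using covering_cycle[OF A] by blast
  obtain n where n: "0 < n" "\<And>h j. mV h \<le> drop_word E (concat (replicate n c)) h j"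
    using drop_word_cover[OF conn c(2)] by blast
  define w where "w = concat (replicate n c)"
  have w: "driven_path A v0 w v0" "\<And>h j. mV h \<le> drop_word E w h j"
    using driven_path_concat_replicate[OF c(1)] n(2) by (simp_all add: w_def)
  have "v0 \<in> set w" using c(2) n(1) by (simp add: w_def)
  then have w0: "0 < length w" by auto
  \<comment> \<open>Coalescing word of \<open>profile_coalesces\<close>, a driven loop at
    \<open>v0\<close>; a path of length \<open>L\<close> leads to \<open>v0\<close> from anywhere,
    whence \<open>N = L + length x\<close>.\<close>
  define x where "x = w @ replicate (2 * length w) v0 @ w"
  have x: "driven_path A v0 x v0"
    unfolding x_def
    by (rule driven_path_append[OF w(1) driven_path_append[OF driven_path_replicate[OF A(2)] w(1)]])
  define z where "z = (profile (drop_word E w (\<lambda>j. if j = v0 then 0 else - int (length w))), v0)"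
  define N where "N = L + length x"
  have N: "0 < N" using w0 by (simp add: N_def x_def)
  obtain \<delta> where \<delta>: "0 < \<delta>" "\<delta> \<le> 1" "\<And>v v'. v' \<in> set_pmf (A v) \<Longrightarrow> \<delta> \<le> pmf (A v) v'"
    using kernel_positive_lower_bound[of A] by blast
  have "\<delta> ^ N \<le> pmf (law_at (Q_mc E A) (return_pmf s) N) z" for s
  proof -
    obtain h v where s: "s = (h, v)" by force
    obtain u where u: "length u = L" "driven_path A v u v0" using L by blast
    have "\<delta> ^ N \<le> pmf (law_at (K_mc E A) (return_pmf (h, v)) N) (drop_word E (u @ x) h, v0)"
      using pmf_law_at_driven_path[OF \<delta>(3) _ driven_path_append[OF u(2) x], of E h] \<delta>(1) u(1)
      by (simp add: N_def)
    also have "\<dots> \<le> pmf (map_pmf relative (law_at (K_mc E A) (return_pmf (h, v)) N)) (relative (drop_word E (u @ x) h, v0))"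
      by (rule pmf_map_ge)
    also have "relative (drop_word E (u @ x) h, v0) = z"
      using profile_coalesces[where E=E and w=w and v=v0 and h="drop_word E u h"] w(2)
      by (simp add: relative_def z_def x_def)
    also have "map_pmf relative (law_at (K_mc E A) (return_pmf (h, v)) N) = law_at (Q_mc E A) (return_pmf s) N"
      by (simp add: map_relative_law_at s law_at_Q_mc_relative[OF N, of E A "(h, v)"])
    finally show ?thesis .
  qed
  then have "doeblin (Q_mc E A) N (\<delta> ^ N) z"
    using N \<delta> by (auto simp: doeblin_def power_le_one)
  then show ?thesis by (rule that)
qed

section \<open>The maximum height under Markov chain droppings\<close>

interpretation mc: unit_increments "K_mc E A" "\<lambda>s. real_of_int (mV (fst s))"
  for E :: "'v::finite \<Rightarrow> 'v \<Rightarrow> bool" and A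
proof
  fix s s' :: "('v \<Rightarrow> int) \<times> 'v"
  assume "s' \<in> set_pmf (K_mc E A s)"
  then obtain x where "s' = (T_op E x (fst s), x)" by (auto simp: K_mc_def)
  then show "real_of_int (mV (fst s)) \<le> real_of_int (mV (fst s'))
      \<and> real_of_int (mV (fst s')) \<le> real_of_int (mV (fst s)) + 1"
    using mV_T_op[where h="fst s" and E=E and i=x] by simp
qed

lemma mc_drift_relative: "mc.drift E A n (relative s) = mc.drift E A n s"
proof -
  define c where "c = - mV (fst s)"
  \<comment> \<open>A shift by a constant fixed at the start. Unlike \<open>relative\<close>, which
    would discard the growth of the maximum, it commutes with \<open>K_mc\<close> itself, and it
    sends \<open>s\<close> to \<open>relative s\<close>.\<close>
  define S where "S = (\<lambda>s :: ('a \<Rightarrow> int) \<times> 'a. (translate c (fst s), snd s))"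
  have "map_pmf S (law_at (K_mc E A) (return_pmf s) n) = law_at (K_mc E A) (return_pmf (S s)) n"
    using map_law_at[of S "K_mc E A" "K_mc E A" "return_pmf s" n]
    by (simp add: S_def K_mc_def map_pmf_comp T_op_translate)
  moreover have "S s = relative s"
    by (simp add: S_def c_def relative_def profile_eq_translate)
  ultimately have law: "law_at (K_mc E A) (return_pmf (relative s)) n = map_pmf S (law_at (K_mc E A) (return_pmf s) n)"
    by simp
  have "integrable (measure_pmf (law_at (K_mc E A) (return_pmf s) n)) (\<lambda>s. real_of_int (mV (fst s)))"
  proof (rule integrable_pmf_bounded)
    fix x assume "x \<in> set_pmf (law_at (K_mc E A) (return_pmf s) n)"
    from mc.law_return_range[OF this]
    show "\<bar>real_of_int (mV (fst x))\<bar> \<le> \<bar>real_of_int (mV (fst s))\<bar> + real n" by linarith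
  qed
  then have "EE (law_at (K_mc E A) (return_pmf s) n) (\<lambda>x. real_of_int (mV (fst (S x))))
      = EE (law_at (K_mc E A) (return_pmf s) n) (\<lambda>s. real_of_int (mV (fst s))) + c"
    by (simp add: S_def mV_translate)
  then show ?thesis
    by (simp add: mc.drift_def law c_def) (simp add: relative_def mV_profile)
qed

lemma conv_in_law_map: "conv_in_law \<mu>s \<nu> \<Longrightarrow> conv_in_law (\<lambda>t. map_pmf f (\<mu>s t)) (map_pmf f \<nu>)"
  unfolding conv_in_law_def
proof (intro allI impI)
  fix g :: "'b \<Rightarrow> real"
  assume *: "\<forall>f. bounded (range f) \<longrightarrow> (\<lambda>t. EE (\<mu>s t) f) \<longlonglongrightarrow> EE \<nu> f" and g: "bounded (range g)"
  have "bounded (range (\<lambda>x. g (f x)))" using g by (rule bounded_subset) auto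
  with * show "(\<lambda>t. EE (map_pmf f (\<mu>s t)) g) \<longlonglongrightarrow> EE (map_pmf f \<nu>) g" by simp
qed

text \<open>Invariance writes \<open>\<pi>\<close> as a law of normalised states. Equilibrium thus
  starts with a deterministic maximum, as the concentration bound requires.\<close>

lemma invariant_mc_mV:
  assumes "invariant_mc E A \<pi>" "s \<in> set_pmf \<pi>"
  shows "mV (fst s) = 0"
proof -
  have "s \<in> set_pmf (map_pmf (\<lambda>s. (profile (fst s), snd s)) (bind_pmf \<pi> (K_mc E A)))"
    using assms unfolding invariant_mc_def by simp
  then show ?thesis by (auto simp: mV_profile)
qed

text \<open>The three claims share one oscillation bound \<open>B\<close>. Concentration is stated
  for every initial law with constant maximum, which covers equilibrium and fixed starts with the
  same \<open>c\<close>.\<close>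

lemma mc_model:
  fixes E :: "'v::finite \<Rightarrow> 'v \<Rightarrow> bool"
  assumes conn: "connected_graph E" and A: "irreducible_kernel A" "lazy_kernel A"
  defines "m \<equiv> \<lambda>s :: ('v \<Rightarrow> int) \<times> 'v. real_of_int (mV (fst s))"
  shows mc_convergence: "\<exists>\<pi>. invariant_mc E A \<pi> \<and>
      (\<forall>h0 v0. conv_in_law (\<lambda>t. map_pmf (\<lambda>s. profile (fst s)) (law_at (K_mc E A) (return_pmf (h0, v0)) t))
                 (map_pmf fst \<pi>))"
    and mc_concentration: "\<exists>c>0. \<forall>\<mu>. (\<exists>m0. \<forall>s\<in>set_pmf \<mu>. m s = m0) \<longrightarrow> (\<forall>t y. y > 0 \<longrightarrow>
        measure_pmf.prob (law_at (K_mc E A) \<mu> t) {s. \<bar>m s - EE (law_at (K_mc E A) \<mu> t) m\<bar> > y}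
          \<le> 2 * exp (- (c * y\<^sup>2 / (2 * real t))))"
    and mc_expectation: "\<exists>C. \<forall>\<pi>. invariant_mc E A \<pi> \<longrightarrow> (\<forall>v0 t.
        \<bar>EE (law_at (K_mc E A) \<pi> t) m - EE (law_at (K_mc E A) (return_pmf ((\<lambda>_. 0), v0)) t) m\<bar> \<le> C)"
proof -
  obtain N \<epsilon> z where D: "doeblin (Q_mc E A) N \<epsilon> z" using doeblin_Q_mc[OF conn A] by blast
  define B where "B = real N / \<epsilon>"
  have B: "0 \<le> B" using D by (simp add: B_def doeblin_def)
  have osc: "\<bar>mc.drift E A n s - mc.drift E A n s'\<bar> \<le> B" for n s s'
    unfolding B_def by (rule mc.drift_oscillation[OF D, of relative])
      (rule map_relative_K_mc, rule mc_drift_relative)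
  obtain \<pi> where \<pi>: "bind_pmf \<pi> (Q_mc E A) = \<pi>" using doeblin_invariant_exists[OF D] by blast
  have "conv_in_law (\<lambda>t. map_pmf (\<lambda>s. profile (fst s)) (law_at (K_mc E A) (return_pmf (h0, v0)) t)) (map_pmf fst \<pi>)" for h0 v0
  proof -
    have "map_pmf (\<lambda>s. profile (fst s)) (law_at (K_mc E A) (return_pmf (h0, v0)) t)
        = map_pmf fst (law_at (Q_mc E A) (return_pmf (relative (h0, v0))) t)" for t
      using map_relative_law_at[of E A "return_pmf (h0, v0)" t, symmetric]
      by (simp add: map_pmf_comp) (simp add: relative_def)
    then show ?thesis by (simp add: conv_in_law_map[OF doeblin_conv_in_law[OF D \<pi>]])
  qed
  then show "\<exists>\<pi>. invariant_mc E A \<pi> \<and>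
      (\<forall>h0 v0. conv_in_law (\<lambda>t. map_pmf (\<lambda>s. profile (fst s)) (law_at (K_mc E A) (return_pmf (h0, v0)) t))
                 (map_pmf fst \<pi>))"
    using \<pi> by (auto simp: invariant_mc_iff)
  show "\<exists>c>0. \<forall>\<mu>. (\<exists>m0. \<forall>s\<in>set_pmf \<mu>. m s = m0) \<longrightarrow> (\<forall>t y. y > 0 \<longrightarrow>
        measure_pmf.prob (law_at (K_mc E A) \<mu> t) {s. \<bar>m s - EE (law_at (K_mc E A) \<mu> t) m\<bar> > y}
          \<le> 2 * exp (- (c * y\<^sup>2 / (2 * real t))))"
    using B by (intro exI[of _ "1 / (2 * (B + 1)\<^sup>2)"] conjI allI impI)
      (auto simp del: divide_divide_eq_left times_divide_eq_left simp: m_def intro!: mc.concentration[OF osc])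
  have "\<bar>EE (law_at (K_mc E A) \<pi> t) m - EE (law_at (K_mc E A) (return_pmf ((\<lambda>_. 0), v0)) t) m\<bar> \<le> B"
    if inv: "invariant_mc E A \<pi>" for \<pi> v0 t
  proof -
    let ?z = "((\<lambda>_. 0), v0)"
    have m0: "m s = 0" if "s \<in> set_pmf \<pi>" for s
      using invariant_mc_mV[OF inv that] by (simp add: m_def)
    have "EE \<pi> m = EE \<pi> (\<lambda>_. 0)" by (rule expectation_pmf_cong) (rule m0)
    moreover have "EE (law_at (K_mc E A) \<pi> t) m = EE \<pi> m + EE \<pi> (mc.drift E A t)"
      unfolding m_def by (rule mc.expectation_law[where b=0]) (use m0 in \<open>simp add: m_def\<close>)
    ultimately have "EE (law_at (K_mc E A) \<pi> t) m = EE \<pi> (mc.drift E A t)" by simp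
    moreover have "EE (law_at (K_mc E A) (return_pmf ?z) t) m = mc.drift E A t ?z"
      unfolding mc.drift_def m_def by (simp add: mV_def)
    moreover have "mc.drift E A t ?z - B \<le> mc.drift E A t s \<and> mc.drift E A t s \<le> mc.drift E A t ?z + B" for s
      using osc[of t s ?z] by linarith
    then have "mc.drift E A t ?z - B \<le> EE \<pi> (mc.drift E A t)" "EE \<pi> (mc.drift E A t) \<le> mc.drift E A t ?z + B"
      by (rule expectation_pmf_between)+
    ultimately show ?thesis by (simp add: abs_le_iff)
  qed
  then show "\<exists>C. \<forall>\<pi>. invariant_mc E A \<pi> \<longrightarrow> (\<forall>v0 t.
        \<bar>EE (law_at (K_mc E A) \<pi> t) m - EE (law_at (K_mc E A) (return_pmf ((\<lambda>_. 0), v0)) t) m\<bar> \<le> C)"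
    by blast
qed

subsection \<open>Independent droppings as a special case\<close>

lemma map_fst_K_mc_const: "map_pmf fst (K_mc E (\<lambda>_. p) s) = K_ind E p (fst s)"
  by (simp add: K_mc_def K_ind_def map_pmf_comp)

lemma map_fst_law_at_const:
  "map_pmf fst (law_at (K_mc E (\<lambda>_. p)) \<mu> t) = law_at (K_ind E p) (map_pmf fst \<mu>) t"
  by (rule map_law_at) (rule map_fst_K_mc_const)

lemma invariant_ind_of_mc:
  assumes "invariant_mc E (\<lambda>_. p) \<pi>"
  shows "invariant_ind E p (map_pmf fst \<pi>)"
proof -
  have "map_pmf profile (bind_pmf (map_pmf fst \<pi>) (K_ind E p))
      = map_pmf fst (map_pmf (\<lambda>s. (profile (fst s), snd s)) (bind_pmf \<pi> (K_mc E (\<lambda>_. p))))"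
    by (simp add: map_bind_pmf bind_map_pmf map_pmf_comp flip: map_fst_K_mc_const)
  then show ?thesis using assms by (simp add: invariant_ind_def invariant_mc_def)
qed

text \<open>The position to attach is the vertex of the latest dropping, correlated with the
  heights, so the lift is no product law. One step from \<open>\<pi>'\<close> reproduces
  \<open>J\<close>, because a constant driving kernel ignores the attached position.\<close>

lemma invariant_ind_lift:
  assumes "invariant_ind E p \<pi>"
  obtains \<pi>' where "invariant_mc E (\<lambda>_. p) \<pi>'" "map_pmf fst \<pi>' = \<pi>"
proof -
  define J where "J = bind_pmf \<pi> (\<lambda>h. map_pmf (\<lambda>i. (T_op E i h, i)) p)"
  define \<pi>' where "\<pi>' = map_pmf relative J"
  have fst: "map_pmf fst \<pi>' = \<pi>"
    using assms
    by (simp add: \<pi>'_def J_def relative_def invariant_ind_def K_ind_def[abs_def] map_bind_pmf map_pmf_comp)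
  have "bind_pmf \<pi>' (K_mc E (\<lambda>_. p)) = J"
    unfolding J_def fst[symmetric] by (simp add: bind_map_pmf K_mc_def[abs_def])
  then have "invariant_mc E (\<lambda>_. p) \<pi>'"
    by (simp add: invariant_mc_def \<pi>'_def relative_def[abs_def])
  then show ?thesis using fst that by blast
qed

lemma const_kernel:
  assumes "\<And>i. pmf p i > 0"
  shows "irreducible_kernel (\<lambda>_. p)" "lazy_kernel (\<lambda>_. p)"
  using assms by (auto simp: irreducible_kernel_def lazy_kernel_def law_at_Suc intro!: exI[of _ "Suc 0"])

theorem theorem1:
  fixes E :: "'v::finite \<Rightarrow> 'v \<Rightarrow> bool"
  assumes "simple_graph E" and "connected_graph E" and "CARD('v) > 2"
  shows
   "(\<forall>p :: 'v pmf. (\<forall>i. pmf p i > 0) \<longrightarrow>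
      (\<exists>\<pi>. invariant_ind E p \<pi> \<and>
          (\<forall>h0. (\<forall>j. h0 j \<ge> 0) \<longrightarrow>
             conv_in_law (\<lambda>t. map_pmf profile (law_at (K_ind E p) (return_pmf h0) t)) \<pi>))
    \<and> (\<exists>c>0.
          (\<forall>\<pi>. invariant_ind E p \<pi> \<longrightarrow> (\<forall>(t::nat) (y::real). y > 0 \<longrightarrow>
             (let \<mu> = law_at (K_ind E p) \<pi> t in
               measure_pmf.prob \<mu>
                 {h. \<bar>real_of_int (mV h) - measure_pmf.expectation \<mu> (\<lambda>h. real_of_int (mV h))\<bar> > y}
               \<le> 2 * exp (- (c * y\<^sup>2 / (2 * real t))))))
        \<and> (\<forall>h0. (\<forall>j. h0 j \<ge> 0) \<longrightarrow> (\<forall>(t::nat) (y::real). y > 0 \<longrightarrow>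
             (let \<mu> = law_at (K_ind E p) (return_pmf h0) t in
               measure_pmf.prob \<mu>
                 {h. \<bar>real_of_int (mV h) - measure_pmf.expectation \<mu> (\<lambda>h. real_of_int (mV h))\<bar> > y}
               \<le> 2 * exp (- (c * y\<^sup>2 / (2 * real t)))))))
    \<and> (\<exists>C. \<forall>\<pi>. invariant_ind E p \<pi> \<longrightarrow> (\<forall>t.
          \<bar>measure_pmf.expectation (law_at (K_ind E p) \<pi> t) (\<lambda>h. real_of_int (mV h))
           - measure_pmf.expectation (law_at (K_ind E p) (return_pmf (\<lambda>_. 0)) t) (\<lambda>h. real_of_int (mV h))\<bar>
          \<le> C)))
  \<and> (\<forall>A :: 'v \<Rightarrow> 'v pmf. irreducible_kernel A \<and> lazy_kernel A \<longrightarrow>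
      (\<exists>\<pi>. invariant_mc E A \<pi> \<and>
          (\<forall>h0 v0. (\<forall>j. h0 j \<ge> 0) \<longrightarrow>
             conv_in_law (\<lambda>t. map_pmf (\<lambda>s. profile (fst s)) (law_at (K_mc E A) (return_pmf (h0, v0)) t))
               (map_pmf fst \<pi>)))
    \<and> (\<exists>c>0.
          (\<forall>\<pi>. invariant_mc E A \<pi> \<longrightarrow> (\<forall>(t::nat) (y::real). y > 0 \<longrightarrow>
             (let \<mu> = law_at (K_mc E A) \<pi> t in
               measure_pmf.prob \<mu>
                 {s. \<bar>real_of_int (mV (fst s)) - measure_pmf.expectation \<mu> (\<lambda>s. real_of_int (mV (fst s)))\<bar> > y}
               \<le> 2 * exp (- (c * y\<^sup>2 / (2 * real t))))))
        \<and> (\<forall>h0 v0. (\<forall>j. h0 j \<ge> 0) \<longrightarrow> (\<forall>(t::nat) (y::real). y > 0 \<longrightarrow>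
             (let \<mu> = law_at (K_mc E A) (return_pmf (h0, v0)) t in
               measure_pmf.prob \<mu>
                 {s. \<bar>real_of_int (mV (fst s)) - measure_pmf.expectation \<mu> (\<lambda>s. real_of_int (mV (fst s)))\<bar> > y}
               \<le> 2 * exp (- (c * y\<^sup>2 / (2 * real t)))))))
    \<and> (\<exists>C. \<forall>\<pi>. invariant_mc E A \<pi> \<longrightarrow> (\<forall>v0 t.
          \<bar>measure_pmf.expectation (law_at (K_mc E A) \<pi> t) (\<lambda>s. real_of_int (mV (fst s)))
           - measure_pmf.expectation (law_at (K_mc E A) (return_pmf ((\<lambda>_. 0), v0)) t) (\<lambda>s. real_of_int (mV (fst s)))\<bar>
          \<le> C)))"
proof (intro conjI allI impI)
  note conn = assms(2)
  let ?m = "\<lambda>s :: ('v \<Rightarrow> int) \<times> 'v. real_of_int (mV (fst s))"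
  {
    fix p :: "'v pmf" assume "\<forall>i. pmf p i > 0"
    then have A: "irreducible_kernel (\<lambda>_ :: 'v. p)" "lazy_kernel (\<lambda>_ :: 'v. p)"
      using const_kernel[of p] by auto
    have law: "law_at (K_ind E p) (map_pmf fst \<mu>) t = map_pmf fst (law_at (K_mc E (\<lambda>_. p)) \<mu> t)" for \<mu> t
      by (simp add: map_fst_law_at_const)
    \<comment> \<open>The starting position \<open>v\<close> is arbitrary, as the constant kernel
      never reads it; \<open>undefined\<close> is inserted below.\<close>
    have law0: "law_at (K_ind E p) (return_pmf h) t = map_pmf fst (law_at (K_mc E (\<lambda>_. p)) (return_pmf (h, v)) t)"
      for h v t
      using law[of "return_pmf (h, v)" t] by simp
    show "\<exists>\<pi>. invariant_ind E p \<pi> \<and> (\<forall>h0. (\<forall>j. h0 j \<ge> 0) \<longrightarrow>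
             conv_in_law (\<lambda>t. map_pmf profile (law_at (K_ind E p) (return_pmf h0) t)) \<pi>)"
    proof -
      obtain \<pi> where \<pi>: "invariant_mc E (\<lambda>_. p) \<pi>"
        "\<And>h0 v0. conv_in_law (\<lambda>t. map_pmf (\<lambda>s. profile (fst s)) (law_at (K_mc E (\<lambda>_. p)) (return_pmf (h0, v0)) t))
                 (map_pmf fst \<pi>)"
        using mc_convergence[OF conn A] by blast
      show ?thesis
        using invariant_ind_of_mc[OF \<pi>(1)] \<pi>(2)[of _ undefined]
        by (intro exI[of _ "map_pmf fst \<pi>"]) (simp add: law0[of _ _ undefined] map_pmf_comp)
    qed
    obtain c where c: "c > 0"
      "\<And>\<mu> m0 t y. (\<And>s. s \<in> set_pmf \<mu> \<Longrightarrow> ?m s = m0) \<Longrightarrow> y > 0 \<Longrightarrow>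
        measure_pmf.prob (law_at (K_mc E (\<lambda>_. p)) \<mu> t) {s. \<bar>?m s - EE (law_at (K_mc E (\<lambda>_. p)) \<mu> t) ?m\<bar> > y}
          \<le> 2 * exp (- (c * y\<^sup>2 / (2 * real t)))"
      using mc_concentration[OF conn A] by blast
    have conc: "let \<mu>' = law_at (K_ind E p) (map_pmf fst \<mu>) t in
          measure_pmf.prob \<mu>' {h. \<bar>real_of_int (mV h) - measure_pmf.expectation \<mu>' (\<lambda>h. real_of_int (mV h))\<bar> > y}
            \<le> 2 * exp (- (c * y\<^sup>2 / (2 * real t)))"
      if "\<And>s. s \<in> set_pmf \<mu> \<Longrightarrow> ?m s = m0" "y > 0" for \<mu> m0 t y
      using c(2)[OF that, where t=t] by (simp add: law)
    show "\<exists>c>0.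
          (\<forall>\<pi>. invariant_ind E p \<pi> \<longrightarrow> (\<forall>(t::nat) (y::real). y > 0 \<longrightarrow>
             (let \<mu> = law_at (K_ind E p) \<pi> t in
               measure_pmf.prob \<mu>
                 {h. \<bar>real_of_int (mV h) - measure_pmf.expectation \<mu> (\<lambda>h. real_of_int (mV h))\<bar> > y}
               \<le> 2 * exp (- (c * y\<^sup>2 / (2 * real t))))))
        \<and> (\<forall>h0. (\<forall>j. h0 j \<ge> 0) \<longrightarrow> (\<forall>(t::nat) (y::real). y > 0 \<longrightarrow>
             (let \<mu> = law_at (K_ind E p) (return_pmf h0) t in
               measure_pmf.prob \<mu>
                 {h. \<bar>real_of_int (mV h) - measure_pmf.expectation \<mu> (\<lambda>h. real_of_int (mV h))\<bar> > y}
               \<le> 2 * exp (- (c * y\<^sup>2 / (2 * real t))))))"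
    proof (intro exI[of _ c] conjI allI impI)
      fix \<pi> and t :: nat and y :: real assume \<pi>: "invariant_ind E p \<pi>" and y: "y > 0"
      obtain \<pi>' where \<pi>': "invariant_mc E (\<lambda>_. p) \<pi>'" "map_pmf fst \<pi>' = \<pi>"
        using invariant_ind_lift[OF \<pi>] by blast
      show "let \<mu> = law_at (K_ind E p) \<pi> t in
               measure_pmf.prob \<mu>
                 {h. \<bar>real_of_int (mV h) - measure_pmf.expectation \<mu> (\<lambda>h. real_of_int (mV h))\<bar> > y}
               \<le> 2 * exp (- (c * y\<^sup>2 / (2 * real t)))"
        using conc[of \<pi>' 0 y t] invariant_mc_mV[OF \<pi>'(1)] y unfolding \<pi>'(2) by simp
    next
      fix h0 :: "'v \<Rightarrow> int" and t :: nat and y :: real assume y: "y > 0"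
      show "let \<mu> = law_at (K_ind E p) (return_pmf h0) t in
               measure_pmf.prob \<mu>
                 {h. \<bar>real_of_int (mV h) - measure_pmf.expectation \<mu> (\<lambda>h. real_of_int (mV h))\<bar> > y}
               \<le> 2 * exp (- (c * y\<^sup>2 / (2 * real t)))"
        using conc[of "return_pmf (h0, undefined)" "real_of_int (mV h0)" y t] y by simp
    qed (rule c(1))
    obtain C where C: "\<And>\<pi> v0 t. invariant_mc E (\<lambda>_. p) \<pi> \<Longrightarrow>
        \<bar>EE (law_at (K_mc E (\<lambda>_. p)) \<pi> t) ?m - EE (law_at (K_mc E (\<lambda>_. p)) (return_pmf ((\<lambda>_. 0), v0)) t) ?m\<bar> \<le> C"
      using mc_expectation[OF conn A] by blast
    show "\<exists>C. \<forall>\<pi>. invariant_ind E p \<pi> \<longrightarrow> (\<forall>t.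
          \<bar>measure_pmf.expectation (law_at (K_ind E p) \<pi> t) (\<lambda>h. real_of_int (mV h))
           - measure_pmf.expectation (law_at (K_ind E p) (return_pmf (\<lambda>_. 0)) t) (\<lambda>h. real_of_int (mV h))\<bar>
          \<le> C)"
    proof (intro exI[of _ C] allI impI)
      fix \<pi> t assume \<pi>: "invariant_ind E p \<pi>"
      obtain \<pi>' where \<pi>': "invariant_mc E (\<lambda>_. p) \<pi>'" "map_pmf fst \<pi>' = \<pi>"
        using invariant_ind_lift[OF \<pi>] by blast
      show "\<bar>measure_pmf.expectation (law_at (K_ind E p) \<pi> t) (\<lambda>h. real_of_int (mV h))
           - measure_pmf.expectation (law_at (K_ind E p) (return_pmf (\<lambda>_. 0)) t) (\<lambda>h. real_of_int (mV h))\<bar>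
          \<le> C"
        using C[OF \<pi>'(1), where t=t and ?v0.0=undefined]
        by (simp add: law law0[of _ _ undefined] flip: \<pi>'(2))
    qed
  next
    fix A :: "'v \<Rightarrow> 'v pmf" assume "irreducible_kernel A \<and> lazy_kernel A"
    then have A: "irreducible_kernel A" "lazy_kernel A" by auto
    show "\<exists>\<pi>. invariant_mc E A \<pi> \<and>
          (\<forall>h0 v0. (\<forall>j. h0 j \<ge> 0) \<longrightarrow>
             conv_in_law (\<lambda>t. map_pmf (\<lambda>s. profile (fst s)) (law_at (K_mc E A) (return_pmf (h0, v0)) t))
               (map_pmf fst \<pi>))"
      using mc_convergence[OF conn A] by blast
    obtain c where c: "c > 0"
      "\<And>\<mu> m0 t y. (\<And>s. s \<in> set_pmf \<mu> \<Longrightarrow> ?m s = m0) \<Longrightarrow> y > 0 \<Longrightarrow>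
        measure_pmf.prob (law_at (K_mc E A) \<mu> t) {s. \<bar>?m s - EE (law_at (K_mc E A) \<mu> t) ?m\<bar> > y}
          \<le> 2 * exp (- (c * y\<^sup>2 / (2 * real t)))"
      using mc_concentration[OF conn A] by blast
    show "\<exists>c>0.
          (\<forall>\<pi>. invariant_mc E A \<pi> \<longrightarrow> (\<forall>(t::nat) (y::real). y > 0 \<longrightarrow>
             (let \<mu> = law_at (K_mc E A) \<pi> t in
               measure_pmf.prob \<mu>
                 {s. \<bar>real_of_int (mV (fst s)) - measure_pmf.expectation \<mu> (\<lambda>s. real_of_int (mV (fst s)))\<bar> > y}
               \<le> 2 * exp (- (c * y\<^sup>2 / (2 * real t))))))
        \<and> (\<forall>h0 v0. (\<forall>j. h0 j \<ge> 0) \<longrightarrow> (\<forall>(t::nat) (y::real). y > 0 \<longrightarrow>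
             (let \<mu> = law_at (K_mc E A) (return_pmf (h0, v0)) t in
               measure_pmf.prob \<mu>
                 {s. \<bar>real_of_int (mV (fst s)) - measure_pmf.expectation \<mu> (\<lambda>s. real_of_int (mV (fst s)))\<bar> > y}
               \<le> 2 * exp (- (c * y\<^sup>2 / (2 * real t))))))"
      unfolding Let_def
      using c(1) by (intro exI[of _ c] conjI allI impI c(2))
        (simp_all add: invariant_mc_mV)
    show "\<exists>C. \<forall>\<pi>. invariant_mc E A \<pi> \<longrightarrow> (\<forall>v0 t.
          \<bar>measure_pmf.expectation (law_at (K_mc E A) \<pi> t) (\<lambda>s. real_of_int (mV (fst s)))
           - measure_pmf.expectation (law_at (K_mc E A) (return_pmf ((\<lambda>_. 0), v0)) t) (\<lambda>s. real_of_int (mV (fst s)))\<bar>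
          \<le> C)"
      by (rule mc_expectation[OF conn A])
  }
qed

end
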